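(* Let $0<\beta\le 1$ and $\gamma>0$, and let $Z=\{Z_t:t\ge 0\}$ be a super-coalescing Brownian motion (SCBM) with branching rate $\gamma$, $(1+\beta)$-stable branching, and initial measure $Z_0(dx)=dx$ (Lebesgue measure on $\mathbb{R}$). Let $g:[0,\infty)\to[0,\infty)$ be nonnegative, nondecreasing and right continuous, and put $\tau:=\sup\{t\ge 0: Z_t([-g(t),g(t)])\neq 0\}$ (with $\sup\emptyset=0$). If \[\int_1^\infty g(y)\,y^{-1-1/\beta}\,dy=\infty,\] then $\mathbb{P}\{\tau=\infty\}=1$.
   Context: For $t,z\ge 0$ let $\psi_t(z)=z\big(\frac{1+\beta}{1+\beta+\gamma\beta t z^{\beta}}\big)^{1/\beta}$; this is the Laplace exponent of a continuous state branching process (CSBP) with $(1+\beta)$-stable branching: its transition semigroup $Q_t$ satisfies $\int_0^\infty e^{-zy}Q_t(x,dy)=e^{-x\psi_t(z)}$. A coalescing Brownian flow $\{\phi(a,t):a\in\mathbb{R},t\ge0\}$ (Arratia's flow) is a two-parameter process, continuous in $t$, nondecreasing and right continuous in $a$, such that for any $a_1,\dots,a_n$ the process $(\phi(a_1,t),\dots,\phi(a_n,t))$ is a coalescing Brownian motion started at $(a_1,\dots,a_n)$. An SCBM with initial Radon measure $\mu$ on $\mathbb{R}$ is a Markov process taking values in purely atomic Radon measures (for $t>0$) with $X_0=\mu$ and $\mathbb{E}[\exp\{-\langle X_t,f\rangle\}]=\mathbb{E}[\exp\{-\int_{\mathbb{R}}\psi_t(f(\phi(a,t)))\mu(da)\}]$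 for all bounded Borel $f$ with bounded support and the transition semigroup given by the same formula. *)

theory Defs
  imports "HOL-Probability.Probability"
begin

section \<open>Laplace exponent of the (1+beta)-stable CSBP\<close>

definition psi :: "real \<Rightarrow> real \<Rightarrow> real \<Rightarrow> real \<Rightarrow> real" where
  "psi \<beta> \<gamma> t z = z * ((1 + \<beta>) / (1 + \<beta> + \<gamma> * \<beta> * t * z powr \<beta>)) powr (1 / \<beta>)"

definition brownian_motion :: "'b measure \<Rightarrow> real \<Rightarrow> (real \<Rightarrow> 'b \<Rightarrow> real) \<Rightarrow> bool" where
  "brownian_motion M a B \<longleftrightarrow>
     prob_space M \<and>
     (\<forall>t. B t \<in> borel_measurable M) \<and>
     (\<forall>\<omega>\<in>space M. B 0 \<omega> = a) \<and>
     (\<forall>\<omega>\<in>space M. continuous_on {0..} (\<lambda>t. B t \<omega>)) \<and>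
     (\<forall>ts :: real list. sorted_wrt (<) ts \<longrightarrow> (\<forall>t\<in>set ts. 0 \<le> t) \<longrightarrow>
        prob_space.indep_vars M (\<lambda>_. borel)
          (\<lambda>i \<omega>. B (ts ! Suc i) \<omega> - B (ts ! i) \<omega>) {..<length ts - 1} \<and>
        (\<forall>i < length ts - 1.
           distributed M lborel (\<lambda>\<omega>. B (ts ! Suc i) \<omega> - B (ts ! i) \<omega>)
             (\<lambda>x. ennreal (normal_density 0 (sqrt (ts ! Suc i - ts ! i)) x))))"

primrec coal_list :: "(nat \<Rightarrow> real \<Rightarrow> real) \<Rightarrow> nat \<Rightarrow> (real \<Rightarrow> real) list" where
  "coal_list W 0 = [W 0]"
| "coal_list W (Suc k) =
     (let prev = coal_list W k;
          S = {t. 0 \<le> t \<and> (\<exists>j\<le>k. W (Suc k) t = (prev ! j) t)}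
      in if S = {} then prev @ [W (Suc k)]
         else (let T = Inf S;
                   j0 = (LEAST j. j \<le> k \<and> W (Suc k) T = (prev ! j) T)
               in prev @ [(\<lambda>t. if t < T then W (Suc k) t else (prev ! j0) t)]))"

definition coal :: "(nat \<Rightarrow> real \<Rightarrow> real) \<Rightarrow> nat \<Rightarrow> real \<Rightarrow> real" where
  "coal W k = coal_list W k ! k"

definition coalescing_bm :: "'b measure \<Rightarrow> real list \<Rightarrow> (nat \<Rightarrow> real \<Rightarrow> 'b \<Rightarrow> real) \<Rightarrow> bool" where
  "coalescing_bm N as X \<longleftrightarrow>
     prob_space N \<and> (\<forall>i t. X i t \<in> borel_measurable N) \<and>
     (\<exists>(M :: (nat \<Rightarrow> real \<Rightarrow> real) measure) W.
        prob_space M \<and>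
        (\<forall>i < length as. brownian_motion M (as ! i) (W i)) \<and>
        prob_space.indep_vars M (\<lambda>_. Pi\<^sub>M UNIV (\<lambda>_. borel)) (\<lambda>i \<omega>. \<lambda>t. W i t \<omega>) {..<length as} \<and>
        (\<forall>T. finite T \<longrightarrow> T \<subseteq> {0..} \<longrightarrow>
           distr N (Pi\<^sub>M ({..<length as} \<times> T) (\<lambda>_. borel))
              (\<lambda>\<omega>. \<lambda>p\<in>{..<length as} \<times> T. X (fst p) (snd p) \<omega>) =
           distr M (Pi\<^sub>M ({..<length as} \<times> T) (\<lambda>_. borel))
              (\<lambda>\<omega>. \<lambda>p\<in>{..<length as} \<times> T. coal (\<lambda>i t. W i t \<omega>) (fst p) (snd p))))"

definition coalescing_brownian_flow :: "'b measure \<Rightarrow> (real \<Rightarrow> real \<Rightarrow> 'b \<Rightarrow> real) \<Rightarrow> bool" where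
  "coalescing_brownian_flow N \<phi> \<longleftrightarrow>
     prob_space N \<and>
     (\<forall>a t. \<phi> a t \<in> borel_measurable N) \<and>
     (\<forall>\<omega>\<in>space N. \<forall>a. continuous_on {0..} (\<lambda>t. \<phi> a t \<omega>)) \<and>
     (\<forall>\<omega>\<in>space N. \<forall>t\<ge>0. mono (\<lambda>a. \<phi> a t \<omega>) \<and>
                          (\<forall>a. continuous (at_right a) (\<lambda>b. \<phi> b t \<omega>))) \<and>
     (\<forall>as. as \<noteq> [] \<longrightarrow> coalescing_bm N as (\<lambda>i t \<omega>. \<phi> (as ! i) t \<omega>))"

definition elap :: "ennreal \<Rightarrow> real" where
  "elap x = (if x = \<infinity> then 0 else exp (- enn2real x))"

definition lap :: "real measure \<Rightarrow> (real \<Rightarrow> real) \<Rightarrow> real" where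
  "lap \<mu> f = elap (\<integral>\<^sup>+ x. ennreal (f x) \<partial>\<mu>)"

text \<open>E[exp(- int psi_t(f(phi(a,t))) mu(da))], the Laplace functional of Q_t(mu, .)\<close>
definition scbm_kernel :: "real \<Rightarrow> real \<Rightarrow> 'b measure \<Rightarrow> (real \<Rightarrow> real \<Rightarrow> 'b \<Rightarrow> real)
    \<Rightarrow> real \<Rightarrow> real measure \<Rightarrow> (real \<Rightarrow> real) \<Rightarrow> real" where
  "scbm_kernel \<beta> \<gamma> N \<phi> t \<mu> f =
     (\<integral> \<omega>. elap (\<integral>\<^sup>+ a. ennreal (psi \<beta> \<gamma> t (f (\<phi> a t \<omega>))) \<partial>\<mu>) \<partial>N)"

definition radon_real :: "real measure \<Rightarrow> bool" where
  "radon_real \<mu> \<longleftrightarrow> sets \<mu> = sets borel \<and> (\<forall>a b. emeasure \<mu> {a..b} < \<infinity>)"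

definition purely_atomic :: "real measure \<Rightarrow> bool" where
  "purely_atomic \<mu> \<longleftrightarrow> (\<exists>C. countable C \<and> emeasure \<mu> (UNIV - C) = 0)"

definition test_fun :: "(real \<Rightarrow> real) \<Rightarrow> bool" where
  "test_fun f \<longleftrightarrow> f \<in> borel_measurable borel \<and> (\<forall>x. 0 \<le> f x) \<and>
     (\<exists>B. \<forall>x. f x \<le> B) \<and> (\<exists>R. \<forall>x. R < \<bar>x\<bar> \<longrightarrow> f x = 0)"

definition scbm :: "real \<Rightarrow> real \<Rightarrow> 'b measure \<Rightarrow> (real \<Rightarrow> real \<Rightarrow> 'b \<Rightarrow> real)
    \<Rightarrow> 'a measure \<Rightarrow> (real \<Rightarrow> 'a measure) \<Rightarrow> (real \<Rightarrow> 'a \<Rightarrow> real measure) \<Rightarrow> real measure \<Rightarrow> bool" where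
  "scbm \<beta> \<gamma> N \<phi> M F Z \<mu> \<longleftrightarrow>
     prob_space M \<and>
     (\<forall>s. subalgebra M (F s)) \<and>
     (\<forall>s t. 0 \<le> s \<longrightarrow> s \<le> t \<longrightarrow> sets (F s) \<subseteq> sets (F t)) \<and>
     (\<forall>\<omega>\<in>space M. Z 0 \<omega> = \<mu>) \<and>
     (\<forall>t\<ge>0. \<forall>\<omega>\<in>space M. radon_real (Z t \<omega>)) \<and>
     (\<forall>t>0. \<forall>\<omega>\<in>space M. purely_atomic (Z t \<omega>)) \<and>
     (\<forall>t\<ge>0. \<forall>A\<in>sets borel. (\<lambda>\<omega>. emeasure (Z t \<omega>) A) \<in> borel_measurable (F t)) \<and>
     (\<forall>s\<ge>0. \<forall>t\<ge>0. \<forall>f. test_fun f \<longrightarrow>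
        (AE \<omega> in M. real_cond_exp M (F s) (\<lambda>\<omega>'. lap (Z (s + t) \<omega>') f) \<omega>
                      = scbm_kernel \<beta> \<gamma> N \<phi> t (Z s \<omega>) f))"

definition scbm_tau :: "(real \<Rightarrow> real) \<Rightarrow> (real \<Rightarrow> 'a \<Rightarrow> real measure) \<Rightarrow> 'a \<Rightarrow> ennreal" where
  "scbm_tau g Z \<omega> = Sup {ennreal t | t. 0 \<le> t \<and> emeasure (Z t \<omega>) {- g t .. g t} \<noteq> 0}"

end

theory Submission
  imports Defs "HOL-Real_Asymp.Real_Asymp"
begin

text \<open>
  Put \<open>t = 2\<^sup>n\<close>, \<open>r = min (g t) (t powr (1/\<beta>))\<close> and \<open>X = 1 - exp (- \<theta> Z\<^sub>t[-r,r])\<close> with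
  \<open>\<theta> = t powr (-1/\<beta>)\<close>, so that \<open>p = \<psi>\<^sub>t(\<theta>)\<close> is a constant multiple of \<open>t powr (-1/\<beta>)\<close>.
  The sum of the \<open>p r\<close> over \<open>n\<close> diverges, and a second moment argument shows that infinitely many of the
  variables \<open>X\<close> are nonzero. All estimates use only the one-point motions of the flow.

  Lower bound for \<open>E X\<close>: the preimage of \<open>[-r,r]\<close> under the flow at time \<open>t\<close> has mean length \<open>2r\<close>, at least
  half of which comes from points within distance \<open>r + 2 sqrt t\<close> of the origin. As \<open>p (r + 2 sqrt t)\<close> is bounded,
  \<open>E X\<close> is at least a multiple of \<open>p r\<close>.

  Covariances: let \<open>s < t\<close>, with \<open>q\<close> in the role of \<open>r\<close> at time \<open>s\<close>. By the Markov property at time \<open>s\<close>, \<open>Z\<^sub>t[-r,r]\<close>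
  is replaced by \<open>Z\<^sub>s(I)\<close> for an independent random interval \<open>I\<close>. For fixed \<open>I\<close> both factors have explicit
  Laplace functionals, which would be independent if the preimage of \<open>I\<close> had length exactly \<open>|I|\<close>.
  The expected error of this replacement is at most the mean displacement, which is at most \<open>sqrt s\<close>, so that the
  covariance is at most \<open>\<psi>\<^sub>t(\<theta>) (2 q + 2 sqrt s)\<close>, where \<open>\<theta> = t powr (-1/\<beta>)\<close>. Since \<open>1/\<beta> \<ge> 1\<close>,
  summing over \<open>t\<close> gives at most a multiple of \<open>E X\<close> at time \<open>s\<close> plus a term that is summable in \<open>s\<close>.
\<close>

section \<open>Laplace exponents\<close>

lemma elap_ennreal: "0 \<le> r \<Longrightarrow> elap (ennreal r) = exp (- r)"
  by (simp add: elap_def)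

lemma elap_nonneg: "0 \<le> elap x"
  and elap_le_1: "elap x \<le> 1"
  by (auto simp: elap_def)

lemma elap_antimono: "x \<le> y \<Longrightarrow> elap y \<le> elap x"
  by (auto simp: elap_def top.extremum_unique enn2real_mono less_top)

lemma elap_add: "elap (x + y) = elap x * elap y"
proof (cases "x = \<infinity> \<or> y = \<infinity>")
  case False
  then have "enn2real (x + y) = enn2real x + enn2real y"
    by (simp add: enn2real_plus less_top)
  then show ?thesis
    using False by (simp add: elap_def exp_add[symmetric])
qed (auto simp: elap_def)

lemma elap_measurable [measurable]: "elap \<in> borel_measurable borel"
  unfolding elap_def by measurable

lemma abs_elap_le_1: "\<bar>elap x\<bar> \<le> 1"
  by (simp add: elap_nonneg elap_le_1)

lemma elap_eq_1_iff: "elap x = 1 \<longleftrightarrow> x = 0"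
  by (cases x) (auto simp: elap_def)

lemma psi_0: "psi \<beta> \<gamma> t 0 = 0"
  by (simp add: psi_def)

context
  fixes \<beta> \<gamma> :: real
  assumes b: "0 < \<beta>" and c: "0 < \<gamma>"
begin

lemma psi_nonneg: "0 \<le> z \<Longrightarrow> 0 \<le> psi \<beta> \<gamma> t z"
  by (simp add: psi_def)

text \<open>In the variable \<open>z powr \<beta>\<close> the exponent acts as a Moebius map; the
  semigroup property and the monotonicity of \<open>psi\<close> are read off from this rational
  form.\<close>

lemma psi_powr:
  assumes "0 \<le> t" "0 \<le> z"
  shows "psi \<beta> \<gamma> t z powr \<beta> = z powr \<beta> * ((1 + \<beta>) / (1 + \<beta> + \<gamma> * \<beta> * t * z powr \<beta>))"
proof -
  have "0 \<le> \<gamma> * \<beta> * t * z powr \<beta>"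
    using b c assms by simp
  then show ?thesis
    using b assms by (simp add: psi_def powr_mult powr_powr)
qed

text \<open>For positive \<open>z\<close>, in the coordinate \<open>1 / z powr \<beta>\<close> each
  \<open>psi \<beta> \<gamma> t\<close> is translation by a fixed multiple of \<open>t\<close>, so
  times add up.\<close>

lemma psi_add:
  assumes "0 \<le> s" "0 \<le> u" "0 \<le> z"
  shows "psi \<beta> \<gamma> s (psi \<beta> \<gamma> u z) = psi \<beta> \<gamma> (s + u) z"
proof -
  define x where "x = z powr \<beta>"
  define d where "d = 1 + \<beta> + \<gamma> * \<beta> * u * x"
  have x: "0 \<le> x" by (simp add: x_def)
  have d: "0 < d" unfolding d_def using b c x assms by (intro add_pos_nonneg) auto
  have e: "0 < d + \<gamma> * \<beta> * s * x" using b c x assms d by (intro add_pos_nonneg) auto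
  have p: "psi \<beta> \<gamma> u z powr \<beta> = x * ((1 + \<beta>) / d)"
    using psi_powr[OF assms(2,3)] by (simp add: x_def d_def)
  have "1 + \<beta> + \<gamma> * \<beta> * s * (x * ((1 + \<beta>) / d)) = (1 + \<beta>) / d * (d + \<gamma> * \<beta> * s * x)"
    using d by (simp add: field_simps)
  then have q: "(1 + \<beta>) / d * ((1 + \<beta>) / (1 + \<beta> + \<gamma> * \<beta> * s * (x * ((1 + \<beta>) / d)))) =
    (1 + \<beta>) / (d + \<gamma> * \<beta> * s * x)"
    using d b e by simp
  have "psi \<beta> \<gamma> s (psi \<beta> \<gamma> u z) =
    z * (((1 + \<beta>) / d) powr (1 / \<beta>) * ((1 + \<beta>) / (1 + \<beta> + \<gamma> * \<beta> * s * (x * ((1 + \<beta>) / d)))) powr (1 / \<beta>))"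
    unfolding psi_def[of _ _ s] p by (simp add: psi_def x_def d_def)
  also have "\<dots> = z * ((1 + \<beta>) / (d + \<gamma> * \<beta> * s * x)) powr (1 / \<beta>)"
    using d b c x assms by (subst q[symmetric], subst powr_mult) auto
  also have "d + \<gamma> * \<beta> * s * x = 1 + \<beta> + \<gamma> * \<beta> * (s + u) * z powr \<beta>"
    by (simp add: d_def x_def algebra_simps)
  finally show ?thesis by (simp add: psi_def)
qed

text \<open>The Moebius map in \<open>z powr \<beta>\<close> is increasing; strict monotonicity of
  \<open>powr \<beta>\<close> on nonnegative reals carries the comparison back to
  \<open>psi\<close>.\<close>

lemma psi_mono:
  assumes "0 \<le> t" "0 \<le> z" "z \<le> w"
  shows "psi \<beta> \<gamma> t z \<le> psi \<beta> \<gamma> t w"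
proof -
  define x y where "x = z powr \<beta>" and "y = w powr \<beta>"
  have xy: "0 \<le> x" "x \<le> y"
    using assms b by (auto simp: x_def y_def intro: powr_mono2)
  define k where "k = \<gamma> * \<beta> * t"
  have k: "0 \<le> k" using assms b c by (simp add: k_def)
  have "x * ((1 + \<beta>) / (1 + \<beta> + k * x)) \<le> y * ((1 + \<beta>) / (1 + \<beta> + k * y))"
  proof -
    have "0 < 1 + \<beta> + k * x" "0 < 1 + \<beta> + k * y"
      using b k xy by (auto intro!: add_pos_nonneg)
    then show ?thesis
      using xy b by (simp add: divide_simps) (simp add: algebra_simps add_mono mult_left_mono)
  qed
  then have "psi \<beta> \<gamma> t z powr \<beta> \<le> psi \<beta> \<gamma> t w powr \<beta>"
    using assms by (simp add: psi_powr x_def y_def k_def)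
  then show ?thesis
    using b assms psi_nonneg[of z t] psi_nonneg[of w t]
    by (metis linorder_not_le order_trans powr_less_mono2)
qed

text \<open>At \<open>z = t powr (- 1 / \<beta>)\<close> the product
  \<open>t * z powr \<beta>\<close> is 1, so the fraction in \<open>psi\<close> no longer depends on
  \<open>t\<close>.\<close>

lemma psi_self_similar:
  assumes "0 < t"
  shows "psi \<beta> \<gamma> t (t powr (- 1 / \<beta>)) = ((1 + \<beta>) / (1 + \<beta> + \<gamma> * \<beta>)) powr (1 / \<beta>) * t powr (- 1 / \<beta>)"
proof -
  have "(t powr (- 1 / \<beta>)) powr \<beta> = 1 / t"
    using b assms by (simp only: powr_powr) (simp add: powr_minus_divide)
  then show ?thesis
    using assms by (simp add: psi_def mult.commute)
qed

end

section \<open>A second moment Borel--Cantelli lemma\<close>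

text \<open>Chebyshev's inequality for the partial sums \<open>S N\<close>: their means
  \<open>s N\<close> diverge, while the row bound on \<open>e\<close> makes their variances grow at
  most linearly in \<open>s N\<close>. Having only finitely many nonzero terms keeps
  \<open>S N\<close> bounded, hence has probability 0.\<close>

lemma (in prob_space) second_moment_infinitely_often:
  fixes X :: "nat \<Rightarrow> 'a \<Rightarrow> real"
  assumes X [measurable]: "\<And>n. X n \<in> borel_measurable M"
    and X0: "\<And>n \<omega>. 0 \<le> X n \<omega>" and X1: "\<And>n \<omega>. X n \<omega> \<le> 1"
    and cov: "\<And>n m. n < m \<Longrightarrow>
      expectation (\<lambda>\<omega>. X n \<omega> * X m \<omega>) \<le> expectation (X n) * expectation (X m) + e n m"
    and e: "\<And>n N. (\<Sum>m = Suc n..<N. e n m) \<le> C * expectation (X n) + d n"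
    and C: "0 \<le> C" and d: "\<And>N. (\<Sum>n<N. d n) \<le> D"
    and div: "\<not> summable (\<lambda>n. expectation (X n))"
  shows "AE \<omega> in M. \<forall>k. \<exists>n\<ge>k. X n \<omega> \<noteq> 0"
proof -
  have bX: "\<bar>X n \<omega>\<bar> \<le> 1" for n \<omega> using X0[of n \<omega>] X1[of n \<omega>] by simp
  have iX [simp]: "integrable M (X n)" for n
    by (rule integrable_const_bound[where B=1]) (use bX in auto)
  have iXX [simp]: "integrable M (\<lambda>\<omega>. X n \<omega> * X m \<omega>)" for n m
    by (rule integrable_const_bound[where B=1]) (use bX in \<open>auto simp: abs_mult intro!: mult_le_one\<close>)
  define x where "x n = expectation (X n)" for n
  define S where "S N \<omega> = (\<Sum>n<N. X n \<omega>)" for N \<omega>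
  define s where "s N = (\<Sum>n<N. x n)" for N
  have [measurable]: "S N \<in> borel_measurable M" for N unfolding S_def by measurable
  have iS [simp]: "integrable M (S N)" for N unfolding S_def by simp
  have iS2 [simp]: "integrable M (\<lambda>\<omega>. (S N \<omega>)\<^sup>2)" for N
    unfolding S_def power2_eq_square sum_product by simp
  have ES: "expectation (S N) = s N" for N unfolding S_def s_def x_def by simp
  have x0: "0 \<le> x n" for n unfolding x_def using X0 by simp
  \<comment> \<open>Each induction step adds column \<open>N\<close> of the covariance errors, once
    on each side of the diagonal; the diagonal term is at most \<open>x N\<close> because
    \<open>X N\<close> takes values in [0, 1].\<close>
  have second: "expectation (\<lambda>\<omega>. (S N \<omega>)\<^sup>2) \<le> (s N)\<^sup>2 + s N + 2 * (\<Sum>n<N. \<Sum>m = Suc n..<N. e n m)" for N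
  proof (induction N)
    case 0 then show ?case by (simp add: S_def s_def)
  next
    case (Suc N)
    have "expectation (\<lambda>\<omega>. (S (Suc N) \<omega>)\<^sup>2) =
      expectation (\<lambda>\<omega>. (S N \<omega>)\<^sup>2 + 2 * (\<Sum>n<N. X n \<omega> * X N \<omega>) + X N \<omega> * X N \<omega>)"
      by (simp add: S_def power2_sum sum_distrib_right[symmetric] power2_eq_square[of "X N _"] ac_simps)
    also have "\<dots> = expectation (\<lambda>\<omega>. (S N \<omega>)\<^sup>2) + 2 * (\<Sum>n<N. expectation (\<lambda>\<omega>. X n \<omega> * X N \<omega>))
        + expectation (\<lambda>\<omega>. X N \<omega> * X N \<omega>)"
      by simp
    also have "\<dots> \<le> ((s N)\<^sup>2 + s N + 2 * (\<Sum>n<N. \<Sum>m = Suc n..<N. e n m))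
        + 2 * (\<Sum>n<N. x n * x N + e n N) + x N"
      using X0 X1
      by (intro add_mono mult_left_mono sum_mono Suc.IH)
        (auto simp: x_def intro!: cov integral_mono mult_left_le)
    also have "\<dots> \<le> (s (Suc N))\<^sup>2 + s (Suc N) + 2 * (\<Sum>n<Suc N. \<Sum>m = Suc n..<Suc N. e n m)"
    proof -
      have "(\<Sum>n<Suc N. \<Sum>m = Suc n..<Suc N. e n m) = (\<Sum>n<N. (\<Sum>m = Suc n..<N. e n m) + e n N)"
        by (simp add: sum.atLeastLessThan_Suc)
      moreover have "(\<Sum>n<N. x n * x N + e n N) = s N * x N + (\<Sum>n<N. e n N)"
        by (simp add: sum.distrib s_def sum_distrib_right)
      moreover have "(s (Suc N))\<^sup>2 = (s N)\<^sup>2 + 2 * (s N * x N) + (x N)\<^sup>2"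
        by (simp add: s_def power2_sum)
      ultimately show ?thesis
        by (simp add: sum.distrib s_def)
    qed
    finally show ?case .
  qed
  have var: "variance (S N) \<le> (1 + 2 * C) * s N + 2 * D" for N
  proof -
    have "(\<Sum>n<N. \<Sum>m = Suc n..<N. e n m) \<le> (\<Sum>n<N. C * x n + d n)"
      unfolding x_def by (intro sum_mono e)
    also have "\<dots> \<le> C * s N + D"
      using d[of N] by (simp add: sum.distrib s_def sum_distrib_left)
    finally show ?thesis
      using second[of N] variance_eq[OF iS iS2, of N] by (simp add: ES algebra_simps)
  qed
  have slim: "filterlim s at_top sequentially"
    unfolding filterlim_at_top
  proof
    fix K
    obtain N where "K < s N"
      using summableI_nonneg_bounded[of x K] div x0 unfolding s_def x_def by (meson not_le)
    moreover have "s N \<le> s n" if "N \<le> n" for n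
      unfolding s_def using that x0 by (intro sum_mono2) auto
    ultimately have "\<forall>n\<ge>N. K \<le> s n" by force
    then show "\<forall>\<^sub>F n in sequentially. K \<le> s n"
      unfolding eventually_sequentially by blast
  qed
  have null: "prob {\<omega> \<in> space M. \<forall>n\<ge>k. X n \<omega> = 0} = 0" (is "prob ?B = 0") for k
  proof -
    have "eventually (\<lambda>N. prob ?B \<le> ((1 + 2 * C) * s N + 2 * D) / (s N - real k)\<^sup>2) sequentially"
      using slim[unfolded filterlim_at_top, rule_format, of "real k + 1"]
    proof eventually_elim
      case (elim N)
      \<comment> \<open>On \<open>?B\<close> at most \<open>k\<close> summands are nonzero and each
        is at most 1, so \<open>S N\<close> is at most \<open>k\<close>, while its mean is at least
        \<open>k + 1\<close>.\<close>
      have "?B \<subseteq> {\<omega> \<in> space M. s N - real k \<le> \<bar>S N \<omega> - expectation (S N)\<bar>}"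
      proof safe
        fix \<omega> assume "\<omega> \<in> space M" and B: "\<forall>n\<ge>k. X n \<omega> = 0"
        have "S N \<omega> \<le> (\<Sum>n<N. if n < k then 1 else 0)"
          unfolding S_def using B X1 by (intro sum_mono) auto
        also have "\<dots> = real (card ({..<N} \<inter> {..<k}))"
          by (simp add: sum.If_cases Int_def)
        also have "\<dots> \<le> real k"
          by (metis Int_lower2 card_lessThan card_mono finite_lessThan of_nat_mono)
        finally show "s N - real k \<le> \<bar>S N \<omega> - expectation (S N)\<bar>"
          using elim by (simp add: ES)
      qed
      then have "prob ?B \<le> prob {\<omega> \<in> space M. s N - real k \<le> \<bar>S N \<omega> - expectation (S N)\<bar>}"
        by (intro finite_measure_mono) auto
      also have "\<dots> \<le> variance (S N) / (s N - real k)\<^sup>2"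
        using elim by (intro Chebyshev_inequality) auto
      also have "\<dots> \<le> ((1 + 2 * C) * s N + 2 * D) / (s N - real k)\<^sup>2"
        by (intro divide_right_mono var) auto
      finally show ?case .
    qed
    moreover have "((\<lambda>N. ((1 + 2 * C) * s N + 2 * D) / (s N - real k)\<^sup>2) \<longlongrightarrow> 0) sequentially"
    proof (rule filterlim_compose[OF _ slim])
      show "((\<lambda>y. ((1 + 2 * C) * y + 2 * D) / (y - real k)\<^sup>2) \<longlongrightarrow> 0) at_top"
        by real_asymp
    qed
    ultimately have "prob ?B \<le> 0"
      by (intro tendsto_le[OF _ _ tendsto_const]) auto
    then show ?thesis by (simp add: measure_le_0_iff)
  qed
  have "AE \<omega> in M. \<forall>k. \<not> (\<forall>n\<ge>k. X n \<omega> = 0)"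
    unfolding AE_all_countable
  proof
    fix k
    show "AE \<omega> in M. \<not> (\<forall>n\<ge>k. X n \<omega> = 0)"
      using null[of k] by (subst AE_iff_measurable[OF _ refl]) (auto simp: emeasure_eq_measure)
  qed
  then show ?thesis by simp
qed

section \<open>One-point motion of the flow\<close>

text \<open>A point that the shift moves out of \<open>I\<close> lies within
  \<open>\<bar>x\<bar>\<close> of the endpoint it crosses, and likewise from outside for a point
  moved in. The sign of \<open>x\<close> decides which endpoint; \<open>Inf\<close> and
  \<open>Sup\<close> treat open and closed ends alike.\<close>

lemma translate_out_of_interval:
  fixes I :: "real set"
  assumes I [measurable]: "I \<in> sets borel" and "bounded I" and "is_interval I"
  shows "emeasure lborel {a. a \<in> I \<and> a + x \<notin> I} \<le> ennreal \<bar>x\<bar>"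
    and "emeasure lborel {a. a \<notin> I \<and> a + x \<in> I} \<le> ennreal \<bar>x\<bar>"
proof -
  have conv: "c \<in> I" if "a \<in> I" "b \<in> I" "a \<le> c" "c \<le> b" for a b c
    using mem_is_interval_1_I[OF assms(3) that] .
  have bdd: "bdd_below I" "bdd_above I"
    using assms(2) by (simp_all add: bounded_imp_bdd_below bounded_imp_bdd_above)
  define l u where "l = Inf I" and "u = Sup I"
  have lu: "l \<le> a \<and> a \<le> u" if "a \<in> I" for a
    using that bdd by (auto simp: l_def u_def intro: cInf_lower cSup_upper)
  have out: "a \<ge> u - x" if "a \<in> I" "a + x \<notin> I" "x \<ge> 0" for a
  proof -
    have "b \<le> a + x" if "b \<in> I" for b
      using conv[of a b "a + x"] that \<open>a \<in> I\<close> \<open>a + x \<notin> I\<close> \<open>x \<ge> 0\<close> by linarith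
    then have "u \<le> a + x" unfolding u_def using \<open>a \<in> I\<close> by (intro cSup_least) auto
    then show ?thesis by simp
  qed
  have out': "a \<le> l - x" if "a \<in> I" "a + x \<notin> I" "x \<le> 0" for a
  proof -
    have "a + x \<le> b" if "b \<in> I" for b
      using conv[of b a "a + x"] that \<open>a \<in> I\<close> \<open>a + x \<notin> I\<close> \<open>x \<le> 0\<close> by linarith
    then have "a + x \<le> l" unfolding l_def using \<open>a \<in> I\<close> by (intro cInf_greatest) auto
    then show ?thesis by simp
  qed
  have inn: "a \<le> l" if "a \<notin> I" "a + x \<in> I" "x \<ge> 0" for a
  proof -
    have "a \<le> b" if "b \<in> I" for b
      using conv[of b "a + x" a] that \<open>a \<notin> I\<close> \<open>a + x \<in> I\<close> \<open>x \<ge> 0\<close> by linarith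
    then show ?thesis unfolding l_def using \<open>a + x \<in> I\<close> by (intro cInf_greatest) auto
  qed
  have inn': "u \<le> a" if "a \<notin> I" "a + x \<in> I" "x \<le> 0" for a
  proof -
    have "b \<le> a" if "b \<in> I" for b
      using conv[of "a + x" b a] that \<open>a \<notin> I\<close> \<open>a + x \<in> I\<close> \<open>x \<le> 0\<close> by linarith
    then show ?thesis unfolding u_def using \<open>a + x \<in> I\<close> by (intro cSup_least) auto
  qed
  have "{a. a \<in> I \<and> a + x \<notin> I} \<subseteq> (if 0 \<le> x then {u - x..u} else {l..l - x})"
    using lu out out' by auto
  then have "emeasure lborel {a. a \<in> I \<and> a + x \<notin> I} \<le> emeasure lborel (if 0 \<le> x then {u - x..u} else {l..l - x})"
    by (rule emeasure_mono) auto
  then show "emeasure lborel {a. a \<in> I \<and> a + x \<notin> I} \<le> ennreal \<bar>x\<bar>"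
    by (auto split: if_splits)
  have "{a. a \<notin> I \<and> a + x \<in> I} \<subseteq> (if 0 \<le> x then {l - x..l} else {u..u - x})"
  proof
    fix a assume "a \<in> {a. a \<notin> I \<and> a + x \<in> I}"
    then show "a \<in> (if 0 \<le> x then {l - x..l} else {u..u - x})"
      using lu[of "a + x"] inn[of a] inn'[of a] by auto
  qed
  then have "emeasure lborel {a. a \<notin> I \<and> a + x \<in> I} \<le> emeasure lborel (if 0 \<le> x then {l - x..l} else {u..u - x})"
    by (rule emeasure_mono) auto
  then show "emeasure lborel {a. a \<notin> I \<and> a + x \<in> I} \<le> ennreal \<bar>x\<bar>"
    by (auto split: if_splits)
qed

text \<open>The segment between two points of \<open>I\<close> lies in \<open>I\<close>, so its
  length is at most the measure of \<open>I\<close>.\<close>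

lemma bounded_interval_of_finite_length:
  fixes I :: "real set"
  assumes "I \<in> sets borel" and "is_interval I" and fin: "emeasure lborel I < \<infinity>"
  shows "bounded I"
proof (cases "I = {}")
  case False
  then obtain a where a: "a \<in> I" by auto
  define m where "m = measure lborel I"
  have conv: "c \<in> I" if "a \<in> I" "b \<in> I" "a \<le> c" "c \<le> b" for a b c
    using mem_is_interval_1_I[OF assms(2) that] .
  have len: "d - c \<le> m" if "c \<in> I" "d \<in> I" "c \<le> d" for c d
  proof -
    have sub: "{c..d} \<subseteq> I"
    proof
      fix e assume "e \<in> {c..d}"
      then show "e \<in> I" using conv[of c d e] that by simp
    qed
    have "measure lborel {c..d} \<le> m"
      unfolding m_def using sub assms by (intro measure_mono_fmeasurable) (auto simp: fmeasurable_def)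
    then show ?thesis using that by simp
  qed
  have "dist a b \<le> m" if "b \<in> I" for b
    using len[of a b] len[of b a] a that by (auto simp: dist_real_def abs_if)
  then show ?thesis unfolding bounded_def by blast
qed simp

section \<open>Gaussian displacements; the parameter \<open>t\<close> is the variance\<close>

definition gauss :: "real \<Rightarrow> real measure" where
  "gauss t = density lborel (\<lambda>x. ennreal (normal_density 0 (sqrt t) x))"

lemma sets_gauss [measurable_cong, simp]: "sets (gauss t) = sets borel"
  and space_gauss [simp]: "space (gauss t) = UNIV"
  by (simp_all add: gauss_def)

lemma prob_space_gauss: "0 < t \<Longrightarrow> prob_space (gauss t)"
  unfolding gauss_def by (rule prob_space_normal_density) simp

lemma nn_integral_abs_gauss:
  assumes "0 < t"
  shows "(\<integral>\<^sup>+x. ennreal \<bar>x\<bar> \<partial>gauss t) \<le> ennreal (sqrt t)"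
proof -
  have h: "has_bochner_integral lborel (\<lambda>x. normal_density 0 (sqrt t) x * \<bar>x\<bar>) (sqrt t * sqrt (2 / pi))"
    using normal_moment_abs_odd[of "sqrt t" 0 0] assms by simp
  have "(\<integral>\<^sup>+x. ennreal \<bar>x\<bar> \<partial>gauss t) = (\<integral>\<^sup>+x. ennreal (normal_density 0 (sqrt t) x * \<bar>x\<bar>) \<partial>lborel)"
    unfolding gauss_def using assms
    by (subst nn_integral_density) (auto simp: ennreal_mult'' normal_density_nonneg)
  also have "\<dots> = ennreal (sqrt t * sqrt (2 / pi))"
    using h assms by (intro nn_integral_eq_integral[THEN trans] arg_cong[of _ _ ennreal])
      (auto simp: has_bochner_integral_iff normal_density_nonneg)
  also have "\<dots> \<le> ennreal (sqrt t)"
  proof -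
    have "sqrt (2 / pi) \<le> 1" using pi_ge_two by simp
    then show ?thesis using assms by (intro ennreal_leI mult_left_le) auto
  qed
  finally show ?thesis .
qed

text \<open>Markov's inequality for \<open>\<bar>x\<bar>\<close> at level \<open>2 * sqrt t\<close>,
  twice the bound on its mean.\<close>

lemma measure_gauss_within:
  assumes "0 < t"
  shows "1 / 2 \<le> measure (gauss t) {x. \<bar>x\<bar> \<le> 2 * sqrt t}"
proof -
  interpret prob_space "gauss t" using assms by (rule prob_space_gauss)
  have "emeasure (gauss t) {x \<in> UNIV. 1 \<le> ennreal (1 / (2 * sqrt t)) * ennreal \<bar>x\<bar>}
      \<le> ennreal (1 / (2 * sqrt t)) * (\<integral>\<^sup>+x. ennreal \<bar>x\<bar> * indicator UNIV x \<partial>gauss t)"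
    by (rule nn_integral_Markov_inequality) auto
  also have "\<dots> \<le> ennreal (1 / (2 * sqrt t)) * ennreal (sqrt t)"
    using nn_integral_abs_gauss[OF assms] by (intro mult_left_mono) auto
  also have "\<dots> = ennreal (1 / 2)"
    using assms by (simp add: ennreal_mult[symmetric])
  also have "{x \<in> UNIV. 1 \<le> ennreal (1 / (2 * sqrt t)) * ennreal \<bar>x\<bar>} = {x. 2 * sqrt t \<le> \<bar>x\<bar>}"
    using assms by (auto simp: ennreal_mult[symmetric] field_simps)
  finally have *: "prob {x. 2 * sqrt t \<le> \<bar>x\<bar>} \<le> 1 / 2"
    by (simp add: emeasure_eq_measure ennreal_le_iff del: ennreal_half)
  have "1 = prob ({x. \<bar>x\<bar> \<le> 2 * sqrt t} \<union> {x. 2 * sqrt t \<le> \<bar>x\<bar>})"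
    using prob_space by (simp add: Un_def linear)
  also have "\<dots> \<le> prob {x. \<bar>x\<bar> \<le> 2 * sqrt t} + prob {x. 2 * sqrt t \<le> \<bar>x\<bar>}"
    by (rule measure_Un_le) auto
  finally show ?thesis using * by simp
qed

section \<open>Joint measurability and one-point law of the flow\<close>

locale coalescing_flow =
  fixes N :: "'b measure" and \<phi> :: "real \<Rightarrow> real \<Rightarrow> 'b \<Rightarrow> real"
  assumes flow: "coalescing_brownian_flow N \<phi>"
begin

sublocale N: prob_space N
  using flow by (simp add: coalescing_brownian_flow_def)

lemma flow_measurable [measurable]: "\<phi> a t \<in> borel_measurable N"
  using flow by (simp add: coalescing_brownian_flow_def)

lemma flow_mono: "\<omega> \<in> space N \<Longrightarrow> 0 \<le> t \<Longrightarrow> a \<le> b \<Longrightarrow> \<phi> a t \<omega> \<le> \<phi> b t \<omega>"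
  using flow by (auto simp: coalescing_brownian_flow_def mono_def)

text \<open>By monotonicity and right continuity in the starting point, the value at
  \<open>a\<close> is below \<open>c\<close> iff the value at some rational \<open>b > a\<close> is;
  this writes the sublevel set as a countable union of rectangles.\<close>

lemma flow_measurable_pair [measurable]:
  assumes "0 \<le> t"
  shows "(\<lambda>(\<omega>, a). \<phi> a t \<omega>) \<in> borel_measurable (N \<Otimes>\<^sub>M borel)"
proof (rule borel_measurableI_less)
  fix c
  have "{x \<in> space (N \<Otimes>\<^sub>M borel). (case x of (\<omega>, a) \<Rightarrow> \<phi> a t \<omega>) < c} =
    (\<Union>b\<in>\<rat>. {\<omega> \<in> space N. \<phi> b t \<omega> < c} \<times> {..<b})" (is "?l = ?r")
  proof (intro equalityI subsetI)
    fix x assume "x \<in> ?l"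
    then obtain \<omega> a where x: "x = (\<omega>, a)" "\<omega> \<in> space N" "\<phi> a t \<omega> < c"
      by (auto simp: space_pair_measure)
    have "continuous (at_right a) (\<lambda>b. \<phi> b t \<omega>)"
      using flow x assms by (auto simp: coalescing_brownian_flow_def)
    then have "((\<lambda>b. \<phi> b t \<omega>) \<longlongrightarrow> \<phi> a t \<omega>) (at_right a)"
      by (simp add: continuous_within)
    then have "eventually (\<lambda>b. \<phi> b t \<omega> < c) (at_right a)"
      using x(3) by (rule order_tendstoD)
    then obtain d where d: "a < d" "\<And>b. a < b \<Longrightarrow> b < d \<Longrightarrow> \<phi> b t \<omega> < c"
      by (auto simp: eventually_at_right_field)
    obtain b where "b \<in> \<rat>" "a < b" "b < d" using Rats_dense_in_real[OF d(1)] by auto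
    then show "x \<in> ?r" using x d by auto
  next
    fix x assume "x \<in> ?r"
    then obtain \<omega> a b where x: "x = (\<omega>, a)" "\<omega> \<in> space N" "\<phi> b t \<omega> < c" "a < b"
      by auto
    then show "x \<in> ?l"
      using flow_mono[OF _ assms, of \<omega> a b] by (simp add: space_pair_measure)
  qed
  also have "\<dots> \<in> sets (N \<Otimes>\<^sub>M borel)"
    by (intro sets.countable_UN' countable_rat pair_measureI) auto
  finally show "{x \<in> space (N \<Otimes>\<^sub>M borel). (case x of (\<omega>, a) \<Rightarrow> \<phi> a t \<omega>) < c} \<in> sets (N \<Otimes>\<^sub>M borel)" .
qed

lemma flow_measurable_pair_lborel:
  assumes "0 \<le> t"
  shows "(\<lambda>(\<omega>, a). \<phi> a t \<omega>) \<in> borel_measurable (N \<Otimes>\<^sub>M lborel)"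
  using flow_measurable_pair[OF assms] by (simp cong: measurable_cong_sets)

text \<open>For a one-element list of starting points the coalescing construction returns the
  driving Brownian motion itself, so the value at time \<open>t\<close> is \<open>a\<close> plus a
  Gaussian increment.\<close>

lemma flow_distr:
  assumes t: "0 < t"
  shows "distr N borel (\<phi> a t) = distr (gauss t) borel (\<lambda>x. a + x)"
proof -
  have "coalescing_bm N [a] (\<lambda>i t \<omega>. \<phi> ([a] ! i) t \<omega>)"
    using flow unfolding coalescing_brownian_flow_def by blast
  then obtain M :: "(nat \<Rightarrow> real \<Rightarrow> real) measure" and W where
    bm: "brownian_motion M a (W 0)" and
    eq: "\<And>T. finite T \<Longrightarrow> T \<subseteq> {0..} \<Longrightarrow>
           distr N (Pi\<^sub>M ({..<1::nat} \<times> T) (\<lambda>_. borel))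
              (\<lambda>\<omega>. \<lambda>p\<in>{..<1::nat} \<times> T. \<phi> ([a] ! fst p) (snd p) \<omega>) =
           distr M (Pi\<^sub>M ({..<1::nat} \<times> T) (\<lambda>_. borel))
              (\<lambda>\<omega>. \<lambda>p\<in>{..<1::nat} \<times> T. coal (\<lambda>i t. W i t \<omega>) (fst p) (snd p))"
    unfolding coalescing_bm_def by auto
  have [measurable]: "W 0 t \<in> borel_measurable M" for t
    using bm by (simp add: brownian_motion_def)
  have c0: "coal w 0 = w 0" for w by (simp add: coal_def)
  define P where "P = Pi\<^sub>M ({..<1::nat} \<times> {t}) (\<lambda>_. borel :: real measure)"
  define X where "X \<omega> = (\<lambda>p\<in>{..<1::nat} \<times> {t}. \<phi> ([a] ! fst p) (snd p) \<omega>)" for \<omega>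
  define V where "V \<omega> = (\<lambda>p\<in>{..<1::nat} \<times> {t}. coal (\<lambda>i t. W i t \<omega>) (fst p) (snd p))" for \<omega>
  have X [measurable]: "X \<in> measurable N P" 
    unfolding X_def P_def by (intro measurable_restrict) auto
  have V [measurable]: "V \<in> measurable M P" 
    unfolding V_def P_def by (intro measurable_restrict) (auto simp: c0)
  have proj [measurable]: "(\<lambda>f. f (0, t)) \<in> measurable P borel"
    unfolding P_def by (intro measurable_component_singleton) auto
  have e: "distr N P X = distr M P V"
    using eq[of "{t}"] t unfolding P_def X_def V_def by simp
  have "distr N borel (\<phi> a t) = distr N borel ((\<lambda>f. f (0, t)) \<circ> X)"
    by (intro distr_cong) (auto simp: X_def)
  also have "\<dots> = distr (distr N P X) borel (\<lambda>f. f (0, t))"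
    by (subst distr_distr) auto
  also have "\<dots> = distr M borel ((\<lambda>f. f (0, t)) \<circ> V)"
    unfolding e by (subst distr_distr) auto
  also have "\<dots> = distr M borel ((\<lambda>x. a + x) \<circ> (\<lambda>\<omega>. W 0 t \<omega> - W 0 0 \<omega>))"
    using bm by (intro distr_cong) (auto simp: V_def c0 brownian_motion_def)
  also have "\<dots> = distr (distr M lborel (\<lambda>\<omega>. W 0 t \<omega> - W 0 0 \<omega>)) borel (\<lambda>x. a + x)"
    by (subst distr_distr) auto
  also have "distr M lborel (\<lambda>\<omega>. W 0 t \<omega> - W 0 0 \<omega>) = gauss t"
  proof -
    have "\<forall>ts :: real list. sorted_wrt (<) ts \<longrightarrow> (\<forall>t\<in>set ts. 0 \<le> t) \<longrightarrow>
        (\<forall>i < length ts - 1.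
           distributed M lborel (\<lambda>\<omega>. W 0 (ts ! Suc i) \<omega> - W 0 (ts ! i) \<omega>)
             (\<lambda>x. ennreal (normal_density 0 (sqrt (ts ! Suc i - ts ! i)) x)))"
      using bm by (simp add: brownian_motion_def)
    from this[THEN spec, of "[0, t]"] t show ?thesis
      by (auto simp: distributed_def gauss_def)
  qed
  finally show ?thesis .
qed

lemma flow_nn_integral:
  assumes "0 < t" and [measurable]: "f \<in> borel_measurable borel"
  shows "(\<integral>\<^sup>+\<omega>. f (\<phi> a t \<omega>) \<partial>N) = (\<integral>\<^sup>+x. f (a + x) \<partial>gauss t)"
proof -
  have "(\<integral>\<^sup>+\<omega>. f (\<phi> a t \<omega>) \<partial>N) = (\<integral>\<^sup>+y. f y \<partial>distr N borel (\<phi> a t))"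
    by (subst nn_integral_distr) auto
  also have "\<dots> = (\<integral>\<^sup>+x. f (a + x) \<partial>gauss t)"
    unfolding flow_distr[OF assms(1)] by (subst nn_integral_distr) auto
  finally show ?thesis .
qed

text \<open>Once the integral over starting points is moved outside, each \<open>a\<close>
  contributes through its own path alone, so no joint law of several paths enters. In such means the
  flow may be replaced by one random translation of the whole line.\<close>

lemma flow_fubini:
  assumes t: "0 < t" and h [measurable]: "(\<lambda>(a, y). h a y) \<in> borel_measurable (borel \<Otimes>\<^sub>M borel)"
  shows "(\<integral>\<^sup>+\<omega>. (\<integral>\<^sup>+a. h a (\<phi> a t \<omega>) \<partial>lborel) \<partial>N) =
    (\<integral>\<^sup>+x. (\<integral>\<^sup>+a. h a (a + x) \<partial>lborel) \<partial>gauss t)"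
proof -
  interpret g: prob_space "gauss t" using t by (rule prob_space_gauss)
  interpret NL: pair_sigma_finite N lborel ..
  interpret gL: pair_sigma_finite "gauss t" lborel ..
  note flow_measurable_pair_lborel[OF less_imp_le[OF t], measurable]
  have "(\<integral>\<^sup>+\<omega>. (\<integral>\<^sup>+a. h a (\<phi> a t \<omega>) \<partial>lborel) \<partial>N) = (\<integral>\<^sup>+a. (\<integral>\<^sup>+\<omega>. h a (\<phi> a t \<omega>) \<partial>N) \<partial>lborel)"
    by (rule NL.Fubini'[symmetric]) measurable
  also have "\<dots> = (\<integral>\<^sup>+a. (\<integral>\<^sup>+x. h a (a + x) \<partial>gauss t) \<partial>lborel)"
    using t by (intro nn_integral_cong flow_nn_integral) auto
  also have "\<dots> = (\<integral>\<^sup>+x. (\<integral>\<^sup>+a. h a (a + x) \<partial>lborel) \<partial>gauss t)"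
    by (rule gL.Fubini') measurable
  finally show ?thesis .
qed

end

section \<open>Integration against random measures\<close>

text \<open>Cut down to \<open>[-k, k]\<close> and divided by \<open>m k\<close>, the random
  measures form a subprobability kernel, for which integration preserves measurability. Multiplying
  back and letting \<open>k\<close> grow gives the claim by monotone convergence.\<close>

lemma nn_integral_kernel_measurable:
  fixes \<kappa> :: "'a \<Rightarrow> real measure" and f :: "'a \<Rightarrow> real \<Rightarrow> ennreal"
  assumes sets: "\<And>\<omega>. \<omega> \<in> space M \<Longrightarrow> sets (\<kappa> \<omega>) = sets borel"
    and fin: "\<And>\<omega> a b. \<omega> \<in> space M \<Longrightarrow> emeasure (\<kappa> \<omega>) {a..b} < \<infinity>"
    and meas: "\<And>A. A \<in> sets borel \<Longrightarrow> (\<lambda>\<omega>. emeasure (\<kappa> \<omega>) A) \<in> borel_measurable M"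
    and f: "(\<lambda>(\<omega>, x). f \<omega> x) \<in> borel_measurable (M \<Otimes>\<^sub>M borel)"
  shows "(\<lambda>\<omega>. \<integral>\<^sup>+x. f \<omega> x \<partial>\<kappa> \<omega>) \<in> borel_measurable M"
proof -
  \<comment> \<open>The summand 1 keeps \<open>m k\<close> nonzero on windows without mass, and
    local finiteness keeps it finite, so it can be inverted.\<close>
  define m where "m k \<omega> = 1 + emeasure (\<kappa> \<omega>) {- real k..real k}" for k \<omega>
  have [measurable]: "m k \<in> borel_measurable M" for k unfolding m_def using meas by measurable
  have minv: "m k \<omega> * inverse (m k \<omega>) = 1" if "\<omega> \<in> space M" for k \<omega>
  proof -
    have "m k \<omega> \<noteq> 0" "m k \<omega> \<noteq> \<top>"
      using fin[OF that] by (auto simp: m_def less_top)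
    then show ?thesis
      by (cases "m k \<omega>") (auto simp: inverse_ennreal ennreal_mult[symmetric] order_less_le)
  qed
  define L where "L k \<omega> = density (\<kappa> \<omega>) (\<lambda>x. inverse (m k \<omega>) * indicator {- real k..real k} x)" for k \<omega>
  have fx: "f \<omega> \<in> borel_measurable (\<kappa> \<omega>)" if "\<omega> \<in> space M" for \<omega>
    using measurable_compose[OF measurable_Pair1'[OF that] f] sets[OF that] by (simp cong: measurable_cong_sets)
  have ind: "indicator {- real k..real k} \<in> borel_measurable (\<kappa> \<omega>)" if "\<omega> \<in> space M" for \<omega> k
    using sets[OF that] by (auto intro!: borel_measurable_indicator)
  have L_eq: "emeasure (L k \<omega>) A = inverse (m k \<omega>) * emeasure (\<kappa> \<omega>) ({- real k..real k} \<inter> A)"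
    if "\<omega> \<in> space M" "A \<in> sets borel" for k \<omega> A
  proof -
    have "emeasure (L k \<omega>) A = (\<integral>\<^sup>+x. inverse (m k \<omega>) * indicator ({- real k..real k} \<inter> A) x \<partial>\<kappa> \<omega>)"
      unfolding L_def using that ind[OF that(1)] sets[OF that(1)]
      by (subst emeasure_density) (auto intro!: nn_integral_cong split: split_indicator)
    then show ?thesis
      using that sets[OF that(1)] by (simp add: nn_integral_cmult_indicator)
  qed
  have [measurable]: "L k \<in> measurable M (subprob_algebra borel)" for k
  proof (rule measurable_subprob_algebra)
    fix \<omega> assume w: "\<omega> \<in> space M"
    show "sets (L k \<omega>) = sets borel" using sets[OF w] by (simp add: L_def)
    then have sp: "space (L k \<omega>) = UNIV" using sets_eq_imp_space_eq[of "L k \<omega>" borel] by simp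
    have "emeasure (L k \<omega>) UNIV \<le> inverse (m k \<omega>) * m k \<omega>"
    proof -
      have "emeasure (\<kappa> \<omega>) {- real k..real k} \<le> m k \<omega>" by (simp add: m_def)
      then show ?thesis using L_eq[OF w, of UNIV k] by (simp add: mult_left_mono)
    qed
    also have "\<dots> = 1" using minv[OF w] by (simp add: mult.commute)
    finally show "subprob_space (L k \<omega>)" using sp by (intro subprob_spaceI) auto
  next
    fix A :: "real set" assume A: "A \<in> sets borel"
    have "(\<lambda>\<omega>. inverse (m k \<omega>) * emeasure (\<kappa> \<omega>) ({- real k..real k} \<inter> A)) \<in> borel_measurable M"
      using meas A by measurable
    then show "(\<lambda>\<omega>. emeasure (L k \<omega>) A) \<in> borel_measurable M"
      using L_eq A by (subst measurable_cong) auto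
  qed
  have "(\<lambda>\<omega>. SUP k. m k \<omega> * (\<integral>\<^sup>+x. f \<omega> x \<partial>L k \<omega>)) \<in> borel_measurable M"
    using nn_integral_measurable_subprob_algebra2[OF f] by measurable
  moreover have "(\<integral>\<^sup>+x. f \<omega> x \<partial>\<kappa> \<omega>) = (SUP k. m k \<omega> * (\<integral>\<^sup>+x. f \<omega> x \<partial>L k \<omega>))" if w: "\<omega> \<in> space M" for \<omega>
  proof -
    note [measurable] = ind[OF w] fx[OF w]
    have "m k \<omega> * (\<integral>\<^sup>+x. f \<omega> x \<partial>L k \<omega>) = (\<integral>\<^sup>+x. indicator {- real k..real k} x * f \<omega> x \<partial>\<kappa> \<omega>)" for k
    proof -
      have "m k \<omega> * (\<integral>\<^sup>+x. f \<omega> x \<partial>L k \<omega>) =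
        m k \<omega> * (\<integral>\<^sup>+x. inverse (m k \<omega>) * (indicator {- real k..real k} x * f \<omega> x) \<partial>\<kappa> \<omega>)"
        unfolding L_def by (subst nn_integral_density) (simp_all add: mult.assoc)
      also have "\<dots> = (m k \<omega> * inverse (m k \<omega>)) * (\<integral>\<^sup>+x. indicator {- real k..real k} x * f \<omega> x \<partial>\<kappa> \<omega>)"
        by (subst nn_integral_cmult) (simp_all add: mult.assoc)
      also have "m k \<omega> * inverse (m k \<omega>) = 1" by (rule minv[OF w])
      finally show ?thesis by simp
    qed
    then have "(SUP k. m k \<omega> * (\<integral>\<^sup>+x. f \<omega> x \<partial>L k \<omega>)) =
       (SUP k. \<integral>\<^sup>+x. indicator {- real k..real k} x * f \<omega> x \<partial>\<kappa> \<omega>)" by simp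
    also have "\<dots> = (\<integral>\<^sup>+x. (SUP k. indicator {- real k..real k} x * f \<omega> x) \<partial>\<kappa> \<omega>)"
      by (intro nn_integral_monotone_convergence_SUP[symmetric])
        (auto simp: incseq_def le_fun_def split: split_indicator)
    also have "\<dots> = (\<integral>\<^sup>+x. f \<omega> x \<partial>\<kappa> \<omega>)"
    proof (intro nn_integral_cong antisym SUP_least)
      fix x
      obtain k :: nat where "\<bar>x\<bar> \<le> real k" using real_arch_simple[of "\<bar>x\<bar>"] by blast
      then show "f \<omega> x \<le> (SUP k. indicator {- real k..real k} x * f \<omega> x)"
        by (intro SUP_upper2[of k]) (auto split: split_indicator)
    qed (auto split: split_indicator)
    finally show ?thesis by simp
  qed
  ultimately show ?thesis by (subst measurable_cong) auto
qed

lemma (in prob_space) expectation_enn2real_le: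
  assumes h [measurable]: "h \<in> borel_measurable M" and le: "(\<integral>\<^sup>+x. h x \<partial>M) \<le> ennreal C" and "0 \<le> C"
  shows "integrable M (\<lambda>x. enn2real (h x))" and "expectation (\<lambda>x. enn2real (h x)) \<le> C"
    and "AE x in M. h x < \<infinity>"
proof -
  \<comment> \<open>\<open>enn2real\<close> sends \<open>\<infinity>\<close> to 0, so passing to it
    can only decrease the integral.\<close>
  have "(\<integral>\<^sup>+x. ennreal (enn2real (h x)) \<partial>M) \<le> (\<integral>\<^sup>+x. h x \<partial>M)"
    by (intro nn_integral_mono) (simp add: ennreal_enn2real_if)
  then have b: "(\<integral>\<^sup>+x. ennreal (enn2real (h x)) \<partial>M) \<le> ennreal C" using le by simp
  then show i: "integrable M (\<lambda>x. enn2real (h x))"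
    by (intro integrableI_nonneg) (auto intro: le_less_trans)
  have "ennreal (expectation (\<lambda>x. enn2real (h x))) \<le> ennreal C"
    using nn_integral_eq_integral[OF i] b by simp
  then show "expectation (\<lambda>x. enn2real (h x)) \<le> C" using \<open>0 \<le> C\<close> by (simp add: ennreal_le_iff)
  have "(\<integral>\<^sup>+x. h x \<partial>M) \<noteq> \<infinity>" using le by (auto simp: top_unique)
  then show "AE x in M. h x < \<infinity>"
    using nn_integral_PInf_AE[OF h] by (simp add: less_top)
qed

lemma (in prob_space) integrable_elap:
  "f \<in> borel_measurable M \<Longrightarrow> integrable M (\<lambda>x. elap (f x))"
  by (rule integrable_const_bound[where B=1]) (auto simp: abs_elap_le_1)

section \<open>Preimages of intervals under the flow\<close>

lemma nn_integral_lborel_indicator_shift: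
  assumes [measurable]: "B \<in> sets borel"
  shows "(\<integral>\<^sup>+a. indicator B (a + x :: real) \<partial>lborel) = emeasure lborel B"
proof -
  have "emeasure lborel B = (\<integral>\<^sup>+a. indicator B a \<partial>distr lborel borel ((+) x))"
    using lborel_distr_plus[of x] by simp
  also have "\<dots> = (\<integral>\<^sup>+a. indicator B (a + x) \<partial>lborel)"
    by (subst nn_integral_distr) (auto simp: add.commute)
  finally show ?thesis by simp
qed

context coalescing_flow
begin

text \<open>The length is written as an integral over starting points, the form in which
  \<open>flow_fubini\<close> applies.\<close>

definition preimage_length :: "real \<Rightarrow> real set \<Rightarrow> 'b \<Rightarrow> ennreal" where
  "preimage_length t B \<omega> = (\<integral>\<^sup>+a. indicator B (\<phi> a t \<omega>) \<partial>lborel)"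

lemma flow_measurable_section [measurable]:
  assumes "0 \<le> t" "\<omega> \<in> space N"
  shows "(\<lambda>a. \<phi> a t \<omega>) \<in> borel_measurable borel"
  using measurable_compose[OF measurable_Pair1'[OF assms(2)] flow_measurable_pair[OF assms(1)]] by simp

lemma preimage_nn_integral_measurable:
  assumes "0 \<le> t" and [measurable]: "(\<lambda>(a, y). h a y) \<in> borel_measurable (borel \<Otimes>\<^sub>M borel)"
  shows "(\<lambda>\<omega>. \<integral>\<^sup>+a. h a (\<phi> a t \<omega>) \<partial>lborel) \<in> borel_measurable N"
proof -
  note flow_measurable_pair_lborel[OF assms(1), measurable]
  show ?thesis by measurable
qed

lemma preimage_length_measurable [measurable]:
  "0 \<le> t \<Longrightarrow> B \<in> sets borel \<Longrightarrow> preimage_length t B \<in> borel_measurable N"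
  unfolding preimage_length_def by (rule preimage_nn_integral_measurable) auto

text \<open>Lebesgue measure is translation invariant, so every Gaussian displacement contributes
  the full measure of \<open>B\<close>.\<close>

lemma nn_integral_preimage_length:
  assumes "0 < t" and [measurable]: "B \<in> sets borel"
  shows "(\<integral>\<^sup>+\<omega>. preimage_length t B \<omega> \<partial>N) = emeasure lborel B"
proof -
  interpret g: prob_space "gauss t" using assms(1) by (rule prob_space_gauss)
  have "(\<integral>\<^sup>+\<omega>. preimage_length t B \<omega> \<partial>N) = (\<integral>\<^sup>+x. (\<integral>\<^sup>+a. indicator B (a + x) \<partial>lborel) \<partial>gauss t)"
    unfolding preimage_length_def using assms(1) by (rule flow_fubini) measurable
  also have "\<dots> = emeasure lborel B"
    using g.emeasure_space_1 by (simp add: nn_integral_lborel_indicator_shift)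
  finally show ?thesis .
qed

lemma preimage_interval:
  assumes "0 \<le> t" "\<omega> \<in> space N" "is_interval B"
  shows "is_interval {a. \<phi> a t \<omega> \<in> B}"
  unfolding is_interval_1
proof safe
  fix a b c assume a: "\<phi> a t \<omega> \<in> B" and b: "\<phi> b t \<omega> \<in> B" and ac: "a \<le> c" and cb: "c \<le> b"
  show "\<phi> c t \<omega> \<in> B"
    by (rule mem_is_interval_1_I[OF assms(3) a b flow_mono[OF assms(2,1) ac] flow_mono[OF assms(2,1) cb]])
qed

text \<open>The preimage is an interval because the flow is monotone, and its mean length is finite,
  so its length is almost surely finite. Boundedness is recorded because test functions must have
  bounded support.\<close>

lemma preimage_bounded:
  assumes t: "0 < t" and B [measurable]: "B \<in> sets borel" and "is_interval B" and "emeasure lborel B < \<infinity>"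
  shows "AE \<omega> in N. bounded {a. \<phi> a t \<omega> \<in> B}"
proof -
  have "AE \<omega> in N. preimage_length t B \<omega> \<noteq> \<infinity>"
    using nn_integral_preimage_length[OF t B] assms by (intro nn_integral_PInf_AE) auto
  then show ?thesis
  proof (rule AE_mp, intro AE_I2 impI)
    fix \<omega> assume w: "\<omega> \<in> space N" and fin: "preimage_length t B \<omega> \<noteq> \<infinity>"
    have [measurable]: "(\<lambda>a. \<phi> a t \<omega>) \<in> borel_measurable borel"
      using t w by (intro flow_measurable_section) auto
    have s: "{a. \<phi> a t \<omega> \<in> B} \<in> sets borel" by measurable
    have "preimage_length t B \<omega> = (\<integral>\<^sup>+a. indicator {a. \<phi> a t \<omega> \<in> B} a \<partial>lborel)"
      unfolding preimage_length_def by (intro nn_integral_cong) (auto split: split_indicator)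
    also have "\<dots> = emeasure lborel {a. \<phi> a t \<omega> \<in> B}" using s by simp
    finally show "bounded {a. \<phi> a t \<omega> \<in> B}"
      using fin t w assms(3) s
      by (intro bounded_interval_of_finite_length preimage_interval) (auto simp: less_top)
  qed
qed

text \<open>After \<open>flow_fubini\<close> the inner integral measures the points which
  translation by \<open>x\<close> moves out of \<open>I\<close>, or into it; this is at most
  \<open>\<bar>x\<bar>\<close>, and the Gaussian first moment applies.\<close>

lemma nn_integral_interval_displacement:
  assumes t: "0 < t" and I [measurable]: "I \<in> sets borel" and "bounded I" "is_interval I"
  shows "(\<integral>\<^sup>+\<omega>. (\<integral>\<^sup>+a. indicator I a * indicator (- I) (\<phi> a t \<omega>) \<partial>lborel) \<partial>N) \<le> ennreal (sqrt t)"
    and "(\<integral>\<^sup>+\<omega>. (\<integral>\<^sup>+a. indicator (- I) a * indicator I (\<phi> a t \<omega>) \<partial>lborel) \<partial>N) \<le> ennreal (sqrt t)"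
proof -
  have "(\<integral>\<^sup>+\<omega>. (\<integral>\<^sup>+a. indicator I a * indicator (- I) (\<phi> a t \<omega>) \<partial>lborel) \<partial>N) =
      (\<integral>\<^sup>+x. (\<integral>\<^sup>+a. indicator I a * indicator (- I) (a + x) \<partial>lborel) \<partial>gauss t)"
    using t by (rule flow_fubini) measurable
  also have "\<dots> = (\<integral>\<^sup>+x. (\<integral>\<^sup>+a. indicator {a. a \<in> I \<and> a + x \<notin> I} a \<partial>lborel) \<partial>gauss t)"
    by (intro nn_integral_cong) (auto split: split_indicator)
  also have "\<dots> \<le> (\<integral>\<^sup>+x. ennreal \<bar>x\<bar> \<partial>gauss t)"
    using translate_out_of_interval(1)[OF assms(2-4)] by (intro nn_integral_mono) simp
  also have "\<dots> \<le> ennreal (sqrt t)" by (rule nn_integral_abs_gauss[OF t])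
  finally show "(\<integral>\<^sup>+\<omega>. (\<integral>\<^sup>+a. indicator I a * indicator (- I) (\<phi> a t \<omega>) \<partial>lborel) \<partial>N) \<le> ennreal (sqrt t)" .
  have "(\<integral>\<^sup>+\<omega>. (\<integral>\<^sup>+a. indicator (- I) a * indicator I (\<phi> a t \<omega>) \<partial>lborel) \<partial>N) =
      (\<integral>\<^sup>+x. (\<integral>\<^sup>+a. indicator (- I) a * indicator I (a + x) \<partial>lborel) \<partial>gauss t)"
    using t by (rule flow_fubini) measurable
  also have "\<dots> = (\<integral>\<^sup>+x. (\<integral>\<^sup>+a. indicator {a. a \<notin> I \<and> a + x \<in> I} a \<partial>lborel) \<partial>gauss t)"
    by (intro nn_integral_cong) (auto split: split_indicator)
  also have "\<dots> \<le> (\<integral>\<^sup>+x. ennreal \<bar>x\<bar> \<partial>gauss t)"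
    using translate_out_of_interval(2)[OF assms(2-4)] by (intro nn_integral_mono) simp
  also have "\<dots> \<le> ennreal (sqrt t)" by (rule nn_integral_abs_gauss[OF t])
  finally show "(\<integral>\<^sup>+\<omega>. (\<integral>\<^sup>+a. indicator (- I) a * indicator I (\<phi> a t \<omega>) \<partial>lborel) \<partial>N) \<le> ennreal (sqrt t)" .
qed

text \<open>Only starting points in \<open>[-K, K]\<close> are counted. The truncated length
  \<open>h\<close> still has mean at least \<open>r\<close>, and \<open>p\<close> times
  \<open>h\<close> is at most 6, a range on which \<open>1 - exp (- y)\<close> dominates
  \<open>y / 7\<close>.\<close>

lemma expectation_elap_preimage_length:
  assumes t: "0 < t" and r: "0 \<le> r" and p: "0 \<le> p" and pK: "2 * p * (r + 2 * sqrt t) \<le> 6"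
  shows "p * r / 7 \<le> 1 - N.expectation (\<lambda>\<omega>. elap (ennreal p * preimage_length t {- r..r} \<omega>))"
proof -
  \<comment> \<open>With this \<open>K\<close>, a displacement of size at most
    \<open>2 * sqrt t\<close> can bring only points of \<open>[-K, K]\<close> into
    \<open>[-r, r]\<close>.\<close>
  define K where "K = r + 2 * sqrt t"
  define h where "h \<omega> = (\<integral>\<^sup>+a. indicator {-K..K} a * indicator {-r..r} (\<phi> a t \<omega>) \<partial>lborel)" for \<omega>
  have [measurable]: "h \<in> borel_measurable N"
    unfolding h_def using t by (intro preimage_nn_integral_measurable) auto
  have [measurable]: "preimage_length t {- r..r} \<in> borel_measurable N"
    using t by (intro preimage_length_measurable) auto
  have K: "0 \<le> K" using r t by (simp add: K_def)
  have hK: "h \<omega> \<le> ennreal (2 * K)" for \<omega>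
  proof -
    have "h \<omega> \<le> (\<integral>\<^sup>+a. indicator {-K..K} a \<partial>lborel)"
      unfolding h_def by (intro nn_integral_mono) (auto split: split_indicator)
    then show ?thesis using K by simp
  qed
  have h_le: "h \<omega> \<le> preimage_length t {- r..r} \<omega>" for \<omega>
    unfolding h_def preimage_length_def by (intro nn_integral_mono) (auto split: split_indicator)
  define x where "x \<omega> = enn2real (h \<omega>)" for \<omega>
  have x: "0 \<le> x \<omega>" "x \<omega> \<le> 2 * K" "ennreal (x \<omega>) = h \<omega>" for \<omega>
    using hK[of \<omega>] K by (auto simp: x_def enn2real_leI ennreal_enn2real_if top_unique)
  have [measurable]: "x \<in> borel_measurable N" unfolding x_def by measurable
  have ix: "integrable N x"
    by (rule N.integrable_const_bound[where B="2 * K"]) (use x in auto)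
  interpret g: prob_space "gauss t" using t by (rule prob_space_gauss)
  \<comment> \<open>Such displacements have probability at least 1/2, and for each of them nothing
    of the length \<open>2 * r\<close> is lost to the truncation.\<close>
  have "ennreal (2 * r) * ennreal (1 / 2) \<le> ennreal (2 * r) * emeasure (gauss t) {x. \<bar>x\<bar> \<le> 2 * sqrt t}"
    using measure_gauss_within[OF t] by (intro mult_left_mono) (auto simp: g.emeasure_eq_measure simp del: ennreal_half intro: ennreal_leI)
  also have "\<dots> = (\<integral>\<^sup>+x. ennreal (2 * r) * indicator {x. \<bar>x\<bar> \<le> 2 * sqrt t} x \<partial>gauss t)"
    by (subst nn_integral_cmult_indicator) auto
  also have "\<dots> \<le> (\<integral>\<^sup>+x. (\<integral>\<^sup>+a. indicator {-K..K} a * indicator {-r..r} (a + x) \<partial>lborel) \<partial>gauss t)"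
  proof (intro nn_integral_mono)
    fix x
    show "ennreal (2 * r) * indicator {x. \<bar>x\<bar> \<le> 2 * sqrt t} x \<le>
      (\<integral>\<^sup>+a. indicator {-K..K} a * indicator {-r..r} (a + x) \<partial>lborel)"
    proof (cases "\<bar>x\<bar> \<le> 2 * sqrt t")
      case True
      have "ennreal (2 * r) = (\<integral>\<^sup>+a. indicator {-r..r} (a + x) \<partial>lborel)"
        using r by (subst nn_integral_lborel_indicator_shift) auto
      also have "\<dots> = (\<integral>\<^sup>+a. indicator {-K..K} a * indicator {-r..r} (a + x) \<partial>lborel)"
        using True by (intro nn_integral_cong) (auto simp: K_def split: split_indicator)
      finally show ?thesis using True by simp
    qed simp
  qed
  also have "\<dots> = (\<integral>\<^sup>+\<omega>. h \<omega> \<partial>N)"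
    unfolding h_def using t by (intro flow_fubini[symmetric]) auto
  also have "\<dots> = ennreal (N.expectation x)"
    using nn_integral_eq_integral[OF ix] x by simp
  finally have "ennreal r \<le> ennreal (N.expectation x)"
    using r by (simp add: ennreal_mult[symmetric] del: ennreal_half)
  then have rx: "r \<le> N.expectation x" using x by (simp add: ennreal_le_iff)
  have pw: "elap (ennreal p * preimage_length t {- r..r} \<omega>) \<le> 1 - p / 7 * x \<omega>" for \<omega>
  proof -
    have "elap (ennreal p * preimage_length t {- r..r} \<omega>) \<le> elap (ennreal p * h \<omega>)"
      by (intro elap_antimono mult_left_mono h_le) auto
    also have "\<dots> = exp (- (p * x \<omega>))"
      using x[of \<omega>] p by (simp add: x(3)[symmetric] ennreal_mult[symmetric] elap_ennreal)
    also have "\<dots> \<le> 1 - p / 7 * x \<omega>"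
    proof -
      define y where "y = p * x \<omega>"
      have "y \<le> p * (2 * K)" unfolding y_def using x p by (intro mult_left_mono) auto
      then have y: "0 \<le> y" "y \<le> 6" using x p pK by (auto simp: y_def K_def mult_ac)
      have "exp (- y) = 1 / exp y" by (simp add: exp_minus field_simps)
      also have "\<dots> \<le> 1 / (1 + y)" using y exp_ge_add_one_self[of y] by (intro divide_left_mono) auto
      \<comment> \<open>Clearing denominators leaves \<open>y * y \<le> 6 * y\<close>; the 7 is
        \<open>1 + 6\<close>.\<close>
      also have "\<dots> \<le> 1 - y / 7"
      proof -
        have "y * y \<le> 6 * y" using y by (intro mult_right_mono)
        then show ?thesis using y by (simp add: field_simps)
      qed
      finally show ?thesis by (simp add: y_def)
    qed
    finally show ?thesis .
  qed
  have "N.expectation (\<lambda>\<omega>. elap (ennreal p * preimage_length t {- r..r} \<omega>)) \<le> N.expectation (\<lambda>\<omega>. 1 - p / 7 * x \<omega>)"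
    using pw ix by (intro integral_mono N.integrable_elap) auto
  also have "\<dots> = 1 - p / 7 * N.expectation x" using ix by (simp add: N.prob_space)
  finally show ?thesis
    using mult_left_mono[OF rx, of "p / 7"] p by simp
qed

end

section \<open>Moments of the super-process\<close>

lemma lap_indicator:
  assumes "0 \<le> \<theta>" "Q \<in> sets \<mu>"
  shows "lap \<mu> (\<lambda>x. \<theta> * indicator Q x) = elap (ennreal \<theta> * emeasure \<mu> Q)"
proof -
  have "(\<integral>\<^sup>+x. ennreal (\<theta> * indicator Q x) \<partial>\<mu>) = (\<integral>\<^sup>+x. ennreal \<theta> * indicator Q x \<partial>\<mu>)"
    by (intro nn_integral_cong) (auto split: split_indicator)
  then show ?thesis using assms by (simp add: lap_def nn_integral_cmult_indicator)
qed

lemma lap_two_indicators: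
  assumes "0 \<le> \<theta>" "0 \<le> v" and [measurable]: "Q \<in> sets \<mu>" "I \<in> sets \<mu>"
  shows "lap \<mu> (\<lambda>x. \<theta> * indicator Q x + v * indicator I x) =
    elap (ennreal \<theta> * emeasure \<mu> Q) * elap (ennreal v * emeasure \<mu> I)"
proof -
  have "(\<integral>\<^sup>+x. ennreal (\<theta> * indicator Q x + v * indicator I x) \<partial>\<mu>) =
      (\<integral>\<^sup>+x. ennreal \<theta> * indicator Q x + ennreal v * indicator I x \<partial>\<mu>)"
    using assms by (intro nn_integral_cong) (auto split: split_indicator)
  then show ?thesis
    using assms by (simp add: lap_def nn_integral_add nn_integral_cmult_indicator elap_add)
qed

lemma test_fun_indicator:
  assumes "0 \<le> \<theta>" and [measurable]: "Q \<in> sets borel" and "bounded Q"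
  shows "test_fun (\<lambda>x. \<theta> * indicator Q x)"
proof -
  obtain R where "\<And>x. x \<in> Q \<Longrightarrow> \<bar>x\<bar> \<le> R" using assms(3) by (auto simp: bounded_iff)
  then have "\<forall>x. \<theta> * indicator Q x \<le> \<theta>" "\<forall>x. R < \<bar>x\<bar> \<longrightarrow> \<theta> * indicator Q x = 0"
    using assms(1) by (force split: split_indicator)+
  moreover have "(\<lambda>x. \<theta> * indicator Q x) \<in> borel_measurable borel" by measurable
  ultimately show ?thesis
    using assms(1) unfolding test_fun_def by (metis indicator_pos_le mult_nonneg_nonneg)
qed

lemma test_fun_add:
  assumes "test_fun f" "test_fun g"
  shows "test_fun (\<lambda>x. f x + g x)"
proof -
  obtain A B R S where "\<And>x. f x \<le> A" "\<And>x. g x \<le> B" "\<And>x. R < \<bar>x\<bar> \<Longrightarrow> f x = 0" "\<And>x. S < \<bar>x\<bar> \<Longrightarrow> g x = 0"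
    using assms unfolding test_fun_def by blast
  then have "\<forall>x. f x + g x \<le> A + B" "\<forall>x. max R S < \<bar>x\<bar> \<longrightarrow> f x + g x = 0"
    by (auto intro: add_mono)
  moreover have "(\<lambda>x. f x + g x) \<in> borel_measurable borel" "\<forall>x. 0 \<le> f x + g x"
    using assms unfolding test_fun_def by (auto intro: borel_measurable_add)
  ultimately show ?thesis unfolding test_fun_def by blast
qed

lemma psi_indicator: "psi \<beta> \<gamma> t (\<theta> * indicator Q x) = psi \<beta> \<gamma> t \<theta> * indicator Q x"
  by (auto simp: psi_0 split: split_indicator)

text \<open>Here \<open>x\<close> and \<open>y\<close> are the lengths of the preimages of two intervals under the flow, \<open>m\<close> is the
  length of the second interval and \<open>z\<close> the length of the part of it that the flow carries out of it.\<close>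
lemma exp_perturbation:
  fixes p w x y z m :: real
  assumes "0 \<le> w" "w \<le> p" "0 \<le> x" "0 \<le> y" "0 \<le> z" "m \<le> y + z"
  shows "exp (- (p * x + w * y - w * x)) \<le> exp (- (p * x)) * exp (- (w * m)) + w * (x + z)"
proof -
  have e: "1 - exp (- u) \<le> u" for u :: real using exp_ge_add_one_self[of "- u"] by simp
  have ab: "exp (- a) - exp (- b) \<le> b - a" if "0 \<le> a" "a \<le> b" for a b :: real
  proof -
    have "exp (- a) - exp (- b) = exp (- a) * (1 - exp (- (b - a)))"
      by (simp add: exp_add[symmetric] right_diff_distrib)
    also have "\<dots> \<le> 1 * (b - a)" using that e[of "b - a"] by (intro mult_mono) auto
    finally show ?thesis by simp
  qed
  \<comment> \<open>This is the exponent on the left of the claim. Raising it by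
    \<open>w * (x + z)\<close> removes the term \<open>- w * x\<close> and supplies the
    \<open>w * z\<close> needed for \<open>m \<le> y + z\<close>.\<close>
  have "0 \<le> (p - w) * x + w * y" using assms by (intro add_nonneg_nonneg mult_nonneg_nonneg) auto
  moreover have "w * x \<ge> 0" "w * z \<ge> 0" using assms by auto
  ultimately have "exp (- (p * x + w * y - w * x)) - exp (- (p * x + w * y + w * z)) \<le> w * (x + z)"
    using ab[of "p * x + w * y - w * x" "p * x + w * y + w * z"] by (simp add: algebra_simps)
  moreover have "exp (- (p * x + w * y + w * z)) \<le> exp (- (p * x)) * exp (- (w * m))"
    unfolding exp_add[symmetric] using mult_left_mono[OF assms(6,1)] by (simp add: algebra_simps)
  ultimately show ?thesis by linarith
qed

section \<open>Markov property and Laplace functionals of the process started from Lebesgue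
  measure\<close>

locale scbm_process = coalescing_flow N \<phi>
  for N :: "'b measure" and \<phi> +
  fixes \<beta> \<gamma> :: real
    and M :: "'a measure" and F :: "real \<Rightarrow> 'a measure" and Z :: "real \<Rightarrow> 'a \<Rightarrow> real measure"
  assumes b: "0 < \<beta>" and c: "0 < \<gamma>" and scbm: "scbm \<beta> \<gamma> N \<phi> M F Z lborel"
begin

sublocale M: prob_space M
  using scbm by (simp add: scbm_def)

lemma subalg: "subalgebra M (F s)"
  using scbm by (simp add: scbm_def)

lemma sigma_finite_subalgebra_F: "sigma_finite_subalgebra M (F s)"
  by (intro finite_measure_subalgebra_is_sigma_finite finite_measure_subalgebra.intro
      finite_measure_subalgebra_axioms.intro subalg M.finite_measure_axioms)

lemma sets_Z: "0 \<le> t \<Longrightarrow> \<omega> \<in> space M \<Longrightarrow> sets (Z t \<omega>) = sets borel"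
  and finite_Z: "0 \<le> t \<Longrightarrow> \<omega> \<in> space M \<Longrightarrow> emeasure (Z t \<omega>) {x..y} < \<infinity>"
  using scbm by (simp_all add: scbm_def radon_real_def)

lemma Z_measurable_F: "0 \<le> t \<Longrightarrow> A \<in> sets borel \<Longrightarrow> (\<lambda>\<omega>. emeasure (Z t \<omega>) A) \<in> borel_measurable (F t)"
  using scbm by (simp add: scbm_def)

lemma Z_measurable [measurable]:
  "0 \<le> t \<Longrightarrow> A \<in> sets borel \<Longrightarrow> (\<lambda>\<omega>. emeasure (Z t \<omega>) A) \<in> borel_measurable M"
  using Z_measurable_F subalg by (rule measurable_from_subalg[rotated])

lemma lap_measurable:
  assumes "0 \<le> t" "test_fun f"
  shows "(\<lambda>\<omega>. lap (Z t \<omega>) f) \<in> borel_measurable M"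
proof -
  have [measurable]: "f \<in> borel_measurable borel" using assms(2) by (simp add: test_fun_def)
  have "(\<lambda>\<omega>. \<integral>\<^sup>+x. ennreal (f x) \<partial>Z t \<omega>) \<in> borel_measurable M"
    using assms(1) by (intro nn_integral_kernel_measurable sets_Z finite_Z Z_measurable) auto
  then show ?thesis unfolding lap_def by measurable
qed

lemma integrable_lap:
  assumes "0 \<le> t" "test_fun f"
  shows "integrable M (\<lambda>\<omega>. lap (Z t \<omega>) f)"
  by (rule M.integrable_const_bound[where B=1])
    (use lap_measurable[OF assms] in \<open>auto simp: lap_def abs_elap_le_1\<close>)

lemma markov:
  assumes "0 \<le> s" "0 \<le> t" "test_fun f"
  shows "AE \<omega> in M. real_cond_exp M (F s) (\<lambda>\<omega>'. lap (Z (s + t) \<omega>') f) \<omega>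
                      = scbm_kernel \<beta> \<gamma> N \<phi> t (Z s \<omega>) f"
  using scbm assms by (simp add: scbm_def)

text \<open>The Markov property at time 0, where the state is the deterministic measure
  \<open>lborel\<close>: the conditional expectation is almost surely constant.\<close>

lemma expectation_lap:
  assumes t: "0 \<le> t" and f: "test_fun f"
  shows "M.expectation (\<lambda>\<omega>. lap (Z t \<omega>) f) = scbm_kernel \<beta> \<gamma> N \<phi> t lborel f"
proof -
  interpret sigma_finite_subalgebra M "F 0" by (rule sigma_finite_subalgebra_F)
  have "M.expectation (\<lambda>\<omega>. lap (Z t \<omega>) f) =
      M.expectation (real_cond_exp M (F 0) (\<lambda>\<omega>'. lap (Z t \<omega>') f))"
    using real_cond_exp_int(2)[OF integrable_lap[OF t f]] by simp
  also have "\<dots> = M.expectation (\<lambda>\<omega>. scbm_kernel \<beta> \<gamma> N \<phi> t lborel f)"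
  proof (rule integral_cong_AE)
    have "\<And>\<omega>. \<omega> \<in> space M \<Longrightarrow> Z 0 \<omega> = lborel" using scbm by (simp add: scbm_def)
    then show "AE \<omega> in M. real_cond_exp M (F 0) (\<lambda>\<omega>'. lap (Z t \<omega>') f) \<omega> = scbm_kernel \<beta> \<gamma> N \<phi> t lborel f"
      using markov[of 0 t f] t f by (auto elim!: AE_mp intro!: AE_I2)
  qed auto
  finally show ?thesis by (simp add: M.prob_space)
qed

text \<open>Since \<open>psi\<close> vanishes at 0, it only changes the height of a multiple of an
  indicator. The Laplace transform of a mass thus becomes that of a preimage length, with a new
  rate.\<close>

lemma expectation_elap:
  assumes t: "0 \<le> t" and \<theta>: "0 \<le> \<theta>" and Q: "Q \<in> sets borel" "bounded Q"
  shows "M.expectation (\<lambda>\<omega>. elap (ennreal \<theta> * emeasure (Z t \<omega>) Q)) =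
    N.expectation (\<lambda>\<omega>. elap (ennreal (psi \<beta> \<gamma> t \<theta>) * preimage_length t Q \<omega>))"
proof -
  have "M.expectation (\<lambda>\<omega>. elap (ennreal \<theta> * emeasure (Z t \<omega>) Q)) =
      M.expectation (\<lambda>\<omega>. lap (Z t \<omega>) (\<lambda>x. \<theta> * indicator Q x))"
    using t \<theta> Q by (intro Bochner_Integration.integral_cong) (auto simp: lap_indicator sets_Z)
  also have "\<dots> = scbm_kernel \<beta> \<gamma> N \<phi> t lborel (\<lambda>x. \<theta> * indicator Q x)"
    using assms by (intro expectation_lap test_fun_indicator)
  also have "\<dots> = N.expectation (\<lambda>\<omega>. elap (ennreal (psi \<beta> \<gamma> t \<theta>) * preimage_length t Q \<omega>))"
    unfolding scbm_kernel_def
  proof (intro Bochner_Integration.integral_cong refl arg_cong[of _ _ elap])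
    fix \<omega> assume w: "\<omega> \<in> space N"
    note [measurable] = flow_measurable_section[OF t w] Q(1)
    have "(\<integral>\<^sup>+a. ennreal (psi \<beta> \<gamma> t (\<theta> * indicator Q (\<phi> a t \<omega>))) \<partial>lborel) =
      (\<integral>\<^sup>+a. ennreal (psi \<beta> \<gamma> t \<theta>) * indicator Q (\<phi> a t \<omega>) \<partial>lborel)"
      by (intro nn_integral_cong) (auto simp: psi_0 split: split_indicator)
    also have "\<dots> = ennreal (psi \<beta> \<gamma> t \<theta>) * preimage_length t Q \<omega>"
      unfolding preimage_length_def by (rule nn_integral_cmult) measurable
    finally show "(\<integral>\<^sup>+a. ennreal (psi \<beta> \<gamma> t (\<theta> * indicator Q (\<phi> a t \<omega>))) \<partial>lborel) =
      ennreal (psi \<beta> \<gamma> t \<theta>) * preimage_length t Q \<omega>" .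
  qed
  finally show ?thesis .
qed

text \<open>Both masses are expressed through one flow, so the preimage lengths \<open>X\<close> of
  \<open>Q\<close> and \<open>Y\<close> of \<open>I\<close> are dependent. The proof trades
  \<open>Y\<close> for the constant \<open>m\<close>: in the joint functional this costs at most
  \<open>w * (2 * q + sqrt s)\<close>, and returning from \<open>exp (- (w * m))\<close> to the
  marginal functional of \<open>I\<close> costs another \<open>w * sqrt s\<close>.\<close>

lemma covariance_fixed_interval:
  assumes s: "0 < s" and \<theta>: "0 \<le> \<theta>" and v: "0 \<le> v" and q: "0 \<le> q"
    and I: "I \<in> sets borel" "bounded I" "is_interval I"
    and p: "psi \<beta> \<gamma> s v \<le> psi \<beta> \<gamma> s \<theta>"
  shows "M.expectation (\<lambda>\<omega>. elap (ennreal \<theta> * emeasure (Z s \<omega>) {- q..q}) * elap (ennreal v * emeasure (Z s \<omega>) I))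
    \<le> M.expectation (\<lambda>\<omega>. elap (ennreal \<theta> * emeasure (Z s \<omega>) {- q..q})) *
      M.expectation (\<lambda>\<omega>. elap (ennreal v * emeasure (Z s \<omega>) I)) + psi \<beta> \<gamma> s v * (2 * q + 2 * sqrt s)"
proof -
  define p where "p = psi \<beta> \<gamma> s \<theta>"
  define w where "w = psi \<beta> \<gamma> s v"
  define m where "m = measure lborel I"
  define Q where "Q = {- q..q}"
  define A where "A = (\<lambda>\<omega>. \<integral>\<^sup>+a. ennreal (psi \<beta> \<gamma> s (\<theta> * indicator Q (\<phi> a s \<omega>) + v * indicator I (\<phi> a s \<omega>))) \<partial>lborel)"
  define X where "X = preimage_length s Q"
  define Y where "Y = preimage_length s I"
  define E where "E = (\<lambda>\<omega>. \<integral>\<^sup>+a. indicator I a * indicator (- I) (\<phi> a s \<omega>) \<partial>lborel)"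
  define E' where "E' = (\<lambda>\<omega>. \<integral>\<^sup>+a. indicator (- I) a * indicator I (\<phi> a s \<omega>) \<partial>lborel)"
  note [measurable] = I(1)
  have Qb [measurable]: "Q \<in> sets borel" and "bounded Q" by (auto simp: Q_def)
  have s0: "0 \<le> s" using s by simp
  have w0: "0 \<le> w" and wp: "w \<le> p" and p0: "0 \<le> p"
    using \<theta> v p psi_nonneg b c by (auto simp: w_def p_def)
  have mI: "emeasure lborel I = ennreal m"
    unfolding m_def using emeasure_bounded_finite[OF I(2)] by (intro emeasure_eq_ennreal_measure) (auto simp: less_top)
  have mpos: "0 \<le> m" by (simp add: m_def)
  have [measurable]: "X \<in> borel_measurable N" "Y \<in> borel_measurable N"
    unfolding X_def Y_def using s0 by simp_all
  have [measurable]: "E \<in> borel_measurable N" "E' \<in> borel_measurable N" "A \<in> borel_measurable N"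
    unfolding E_def E'_def A_def psi_def using s0 by (auto intro!: preimage_nn_integral_measurable)
  have EX: "(\<integral>\<^sup>+\<omega>. X \<omega> \<partial>N) \<le> ennreal (2 * q)"
    unfolding X_def using nn_integral_preimage_length[OF s Qb] q by (simp add: Q_def)
  have EY: "(\<integral>\<^sup>+\<omega>. Y \<omega> \<partial>N) \<le> ennreal m"
    unfolding Y_def using nn_integral_preimage_length[OF s I(1)] mI by simp
  have EE: "(\<integral>\<^sup>+\<omega>. E \<omega> \<partial>N) \<le> ennreal (sqrt s)" "(\<integral>\<^sup>+\<omega>. E' \<omega> \<partial>N) \<le> ennreal (sqrt s)"
    unfolding E_def E'_def using nn_integral_interval_displacement[OF s I] by auto
  have q2: "0 \<le> 2 * q" and ss: "0 \<le> sqrt s" using q s0 by simp_all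
  note Xr = N.expectation_enn2real_le[OF \<open>X \<in> _\<close> EX q2]
  note Yr = N.expectation_enn2real_le[OF \<open>Y \<in> _\<close> EY mpos]
  note Er = N.expectation_enn2real_le[OF \<open>E \<in> _\<close> EE(1) ss]
  note Er' = N.expectation_enn2real_le[OF \<open>E' \<in> _\<close> EE(2) ss]
  \<comment> \<open>The lengths \<open>m\<close> and \<open>Y\<close> differ by the starting points
    that the flow carries out of \<open>I\<close>, measured by \<open>E\<close>, and those it
    carries in, measured by \<open>E'\<close>.\<close>
  have YE: "ennreal m \<le> Y \<omega> + E \<omega>" "Y \<omega> \<le> ennreal m + E' \<omega>" if w: "\<omega> \<in> space N" for \<omega>
  proof -
    note [measurable] = flow_measurable_section[OF s0 w]
    have "ennreal m = (\<integral>\<^sup>+a. indicator I a \<partial>lborel)" using mI by simp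
    also have "\<dots> \<le> (\<integral>\<^sup>+a. indicator I (\<phi> a s \<omega>) + indicator I a * indicator (- I) (\<phi> a s \<omega>) \<partial>lborel)"
      by (intro nn_integral_mono) (auto split: split_indicator)
    also have "\<dots> = Y \<omega> + E \<omega>" unfolding Y_def E_def preimage_length_def by (rule nn_integral_add) measurable
    finally show "ennreal m \<le> Y \<omega> + E \<omega>" .
    have "Y \<omega> \<le> (\<integral>\<^sup>+a. indicator I a + indicator (- I) a * indicator I (\<phi> a s \<omega>) \<partial>lborel)"
      unfolding Y_def preimage_length_def by (intro nn_integral_mono) (auto split: split_indicator)
    also have "\<dots> = (\<integral>\<^sup>+a. indicator I a \<partial>lborel) + E' \<omega>" unfolding E'_def by (rule nn_integral_add) measurable
    finally show "Y \<omega> \<le> ennreal m + E' \<omega>" using mI by simp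
  qed
  \<comment> \<open>Where both indicators are 1 the integrand of \<open>A\<close> is
    \<open>psi\<close> at \<open>\<theta> + v\<close>, at least \<open>p\<close> by monotonicity;
    the overlap, counted twice on the left, is paid for by \<open>w * X\<close>. The additive form
    avoids subtraction in \<open>ennreal\<close>.\<close>
  have XYA: "ennreal p * X \<omega> + ennreal w * Y \<omega> \<le> A \<omega> + ennreal w * X \<omega>" if w: "\<omega> \<in> space N" for \<omega>
  proof -
    note [measurable] = flow_measurable_section[OF s0 w]
    have "ennreal p * X \<omega> + ennreal w * Y \<omega> =
      (\<integral>\<^sup>+a. ennreal p * indicator Q (\<phi> a s \<omega>) + ennreal w * indicator I (\<phi> a s \<omega>) \<partial>lborel)"
      unfolding X_def Y_def preimage_length_def by (simp add: nn_integral_add nn_integral_cmult)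
    also have "\<dots> \<le> (\<integral>\<^sup>+a. ennreal (psi \<beta> \<gamma> s (\<theta> * indicator Q (\<phi> a s \<omega>) + v * indicator I (\<phi> a s \<omega>)))
        + ennreal w * indicator Q (\<phi> a s \<omega>) \<partial>lborel)"
      using psi_mono[OF b c s0 \<theta>, of "\<theta> + v"] v
      by (intro nn_integral_mono)
        (auto simp: p_def w_def ennreal_leI psi_0 split: split_indicator intro!: add_right_mono)
    also have "\<dots> = A \<omega> + ennreal w * X \<omega>"
      unfolding A_def X_def preimage_length_def psi_def by (simp add: nn_integral_add nn_integral_cmult)
    finally show ?thesis .
  qed
  have up: "AE \<omega> in N. elap (A \<omega>) \<le> elap (ennreal p * X \<omega>) * exp (- (w * m)) + w * (enn2real (X \<omega>) + enn2real (E \<omega>))"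
    using Xr(3) Yr(3) Er(3) AE_space
  proof eventually_elim
    case (elim \<omega>)
    note fin = elim(1-3) and sp = elim(4)
    obtain x where x: "X \<omega> = ennreal x" "0 \<le> x" using fin by (cases "X \<omega>") auto
    obtain y where y: "Y \<omega> = ennreal y" "0 \<le> y" using fin by (cases "Y \<omega>") auto
    obtain z where z: "E \<omega> = ennreal z" "0 \<le> z" using fin by (cases "E \<omega>") auto
    have mle: "m \<le> y + z"
      using YE(1)[OF sp] y z by (simp add: ennreal_plus[symmetric] ennreal_le_iff del: ennreal_plus)
    show "elap (A \<omega>) \<le> elap (ennreal p * X \<omega>) * exp (- (w * m)) + w * (enn2real (X \<omega>) + enn2real (E \<omega>))"
    proof (cases "A \<omega>")
      case (real a)
      have "ennreal (p * x + w * y) \<le> ennreal (a + w * x)"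
        using XYA[OF sp] real x y w0 p0 by (simp add: ennreal_mult ennreal_plus)
      then have "p * x + w * y \<le> a + w * x"
        using real w0 x by (subst (asm) ennreal_le_iff) auto
      then have "elap (A \<omega>) \<le> exp (- (p * x + w * y - w * x))"
        using real by (simp add: elap_ennreal)
      also have "\<dots> \<le> exp (- (p * x)) * exp (- (w * m)) + w * (x + z)"
        by (rule exp_perturbation) (use w0 wp x y z mle in auto)
      finally show ?thesis
        using x z p0 by (simp add: ennreal_mult[symmetric] elap_ennreal)
    next
      case top
      then show ?thesis using w0 by (simp add: elap_def[of \<top>] elap_nonneg)
    qed
  qed
  have low: "AE \<omega> in N. exp (- (w * m)) \<le> elap (ennreal w * Y \<omega>) + w * enn2real (E' \<omega>)"
    using Er'(3)
  proof (rule AE_mp[OF _ AE_I2], intro impI)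
    fix \<omega> assume sp: "\<omega> \<in> space N" and fin: "E' \<omega> < \<infinity>"
    obtain z where z: "E' \<omega> = ennreal z" "0 \<le> z" using fin by (cases "E' \<omega>") auto
    have Y: "Y \<omega> \<le> ennreal (m + z)" using YE(2)[OF sp] z mpos by simp
    \<comment> \<open>\<open>exp_perturbation\<close> with equal rates and \<open>x = 0\<close>:
      lengthening \<open>m\<close> by \<open>z\<close> lowers the exponential by at most
      \<open>w * z\<close>.\<close>
    have "exp (- (w * m)) \<le> exp (- (w * (m + z))) + w * z"
      using exp_perturbation[of w w 0 m z "m + z"] w0 mpos z by simp
    also have "exp (- (w * (m + z))) \<le> elap (ennreal w * Y \<omega>)"
      using elap_antimono[OF mult_left_mono[OF Y, of "ennreal w"]] w0 mpos z
      by (simp add: ennreal_mult[symmetric] elap_ennreal del: ennreal_plus)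
    finally show "exp (- (w * m)) \<le> elap (ennreal w * Y \<omega>) + w * enn2real (E' \<omega>)" using z by simp
  qed
  have [simp]: "integrable N (\<lambda>\<omega>. elap (ennreal p * X \<omega>))" "integrable N (\<lambda>\<omega>. elap (ennreal w * Y \<omega>))"
    "integrable N (\<lambda>\<omega>. elap (A \<omega>))"
    by (rule N.integrable_elap; measurable)+
  define f where "f = (\<lambda>x. \<theta> * indicator Q x + v * indicator I x :: real)"
  have f: "test_fun f"
    unfolding f_def using \<theta> v I Qb \<open>bounded Q\<close> by (intro test_fun_add test_fun_indicator)
  have "M.expectation (\<lambda>\<omega>. elap (ennreal \<theta> * emeasure (Z s \<omega>) Q) * elap (ennreal v * emeasure (Z s \<omega>) I)) =
      M.expectation (\<lambda>\<omega>. lap (Z s \<omega>) f)"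
    unfolding f_def using s0 \<theta> v I Qb
    by (intro Bochner_Integration.integral_cong refl lap_two_indicators[symmetric]) (auto simp: sets_Z)
  also have "\<dots> = N.expectation (\<lambda>\<omega>. elap (A \<omega>))"
    using expectation_lap[OF s0 f] by (simp add: scbm_kernel_def A_def f_def)
  also have "\<dots> \<le> N.expectation (\<lambda>\<omega>. elap (ennreal p * X \<omega>) * exp (- (w * m)) + w * (enn2real (X \<omega>) + enn2real (E \<omega>)))"
    using up Xr(1) Er(1) by (intro integral_mono_AE) simp_all
  also have "\<dots> = N.expectation (\<lambda>\<omega>. elap (ennreal p * X \<omega>)) * exp (- (w * m)) +
      w * (N.expectation (\<lambda>\<omega>. enn2real (X \<omega>)) + N.expectation (\<lambda>\<omega>. enn2real (E \<omega>)))"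
    using Xr(1) Er(1) by simp
  also have "\<dots> \<le> N.expectation (\<lambda>\<omega>. elap (ennreal p * X \<omega>)) * exp (- (w * m)) + w * (2 * q + sqrt s)"
    using Xr(2) Er(2) q s w0 by (intro add_left_mono mult_left_mono add_mono) auto
  finally have joint: "M.expectation (\<lambda>\<omega>. elap (ennreal \<theta> * emeasure (Z s \<omega>) Q) * elap (ennreal v * emeasure (Z s \<omega>) I))
    \<le> N.expectation (\<lambda>\<omega>. elap (ennreal p * X \<omega>)) * exp (- (w * m)) + w * (2 * q + sqrt s)" .
  have "exp (- (w * m)) = N.expectation (\<lambda>_. exp (- (w * m)))" by (simp add: N.prob_space)
  also have "\<dots> \<le> N.expectation (\<lambda>\<omega>. elap (ennreal w * Y \<omega>) + w * enn2real (E' \<omega>))"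
    using low Er'(1) by (intro integral_mono_AE) simp_all
  also have "\<dots> = N.expectation (\<lambda>\<omega>. elap (ennreal w * Y \<omega>)) + w * N.expectation (\<lambda>\<omega>. enn2real (E' \<omega>))"
    using Er'(1) by simp
  also have "\<dots> \<le> N.expectation (\<lambda>\<omega>. elap (ennreal w * Y \<omega>)) + w * sqrt s"
    using Er'(2) s w0 by (intro add_left_mono mult_left_mono) auto
  finally have lower: "exp (- (w * m)) \<le> N.expectation (\<lambda>\<omega>. elap (ennreal w * Y \<omega>)) + w * sqrt s" .
  have a: "0 \<le> N.expectation (\<lambda>\<omega>. elap (ennreal p * X \<omega>))" "N.expectation (\<lambda>\<omega>. elap (ennreal p * X \<omega>)) \<le> 1"
    by (simp_all add: elap_nonneg elap_le_1 N.integral_le_const)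
  have "N.expectation (\<lambda>\<omega>. elap (ennreal p * X \<omega>)) * exp (- (w * m)) \<le>
    N.expectation (\<lambda>\<omega>. elap (ennreal p * X \<omega>)) * (N.expectation (\<lambda>\<omega>. elap (ennreal w * Y \<omega>)) + w * sqrt s)"
    using lower a by (intro mult_left_mono)
  also have "\<dots> \<le> N.expectation (\<lambda>\<omega>. elap (ennreal p * X \<omega>)) * N.expectation (\<lambda>\<omega>. elap (ennreal w * Y \<omega>)) + w * sqrt s"
    using a w0 s by (simp add: distrib_left mult_left_le_one_le)
  finally have "M.expectation (\<lambda>\<omega>. elap (ennreal \<theta> * emeasure (Z s \<omega>) Q) * elap (ennreal v * emeasure (Z s \<omega>) I))
    \<le> N.expectation (\<lambda>\<omega>. elap (ennreal p * X \<omega>)) * N.expectation (\<lambda>\<omega>. elap (ennreal w * Y \<omega>)) + w * (2 * q + 2 * sqrt s)"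
    using joint by (simp add: algebra_simps)
  also have "N.expectation (\<lambda>\<omega>. elap (ennreal p * X \<omega>)) = M.expectation (\<lambda>\<omega>. elap (ennreal \<theta> * emeasure (Z s \<omega>) Q))"
    using expectation_elap[OF s0 \<theta> Qb \<open>bounded Q\<close>] by (simp add: p_def X_def)
  also have "N.expectation (\<lambda>\<omega>. elap (ennreal w * Y \<omega>)) = M.expectation (\<lambda>\<omega>. elap (ennreal v * emeasure (Z s \<omega>) I))"
    using expectation_elap[OF s0 v I(1,2)] by (simp add: w_def Y_def)
  finally show ?thesis by (simp add: Q_def w_def)
qed

end

section \<open>Covariance of the masses at two times\<close>

context scbm_process
begin

text \<open>Conditioning at time \<open>s\<close> replaces the later mass by \<open>v\<close> times
  \<open>Z s\<close> of the preimage of \<open>[-r, r]\<close> under a flow of duration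
  \<open>u\<close> on the separate space \<open>N\<close>. For almost every fixed
  \<open>\<omega>'\<close> this preimage is a bounded interval, so
  \<open>covariance_fixed_interval\<close> applies; \<open>psi_add\<close> identifies the rate in
  the error.\<close>

lemma covariance:
  assumes s: "0 < s" and u: "0 < u" and \<theta>: "0 \<le> \<theta>" and \<eta>: "0 \<le> \<eta>" and q: "0 \<le> q" and r: "0 \<le> r"
    and p: "psi \<beta> \<gamma> (s + u) \<eta> \<le> psi \<beta> \<gamma> s \<theta>"
  shows "M.expectation (\<lambda>\<omega>. elap (ennreal \<theta> * emeasure (Z s \<omega>) {- q..q}) *
      elap (ennreal \<eta> * emeasure (Z (s + u) \<omega>) {- r..r}))
    \<le> M.expectation (\<lambda>\<omega>. elap (ennreal \<theta> * emeasure (Z s \<omega>) {- q..q})) *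
      M.expectation (\<lambda>\<omega>. elap (ennreal \<eta> * emeasure (Z (s + u) \<omega>) {- r..r})) +
      psi \<beta> \<gamma> (s + u) \<eta> * (2 * q + 2 * sqrt s)"
proof -
  interpret P: pair_prob_space M N ..
  interpret S: sigma_finite_subalgebra M "F s" by (rule sigma_finite_subalgebra_F)
  define v where "v = psi \<beta> \<gamma> u \<eta>"
  have s0: "0 \<le> s" and u0: "0 \<le> u" and su: "0 \<le> s + u" using s u by simp_all
  have v: "0 \<le> v" using \<eta> psi_nonneg b c by (simp add: v_def)
  have pv: "psi \<beta> \<gamma> s v = psi \<beta> \<gamma> (s + u) \<eta>"
    unfolding v_def using b c s0 u0 \<eta> by (rule psi_add)
  define f where "f x = \<eta> * indicator {- r..r} x" for x :: real
  have f: "test_fun f" unfolding f_def using \<eta> by (intro test_fun_indicator) auto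
  define Y where "Y \<omega> = elap (ennreal \<theta> * emeasure (Z s \<omega>) {- q..q})" for \<omega>
  define G where "G \<omega> = elap (ennreal \<eta> * emeasure (Z (s + u) \<omega>) {- r..r})" for \<omega>
  define H where "H \<omega> \<omega>' = ennreal v * (\<integral>\<^sup>+a. indicator {- r..r} (\<phi> a u \<omega>') \<partial>Z s \<omega>)" for \<omega> \<omega>'
  have YF: "Y \<in> borel_measurable (F s)"
    unfolding Y_def using Z_measurable_F[OF s0, of "{- q..q}"] by measurable
  have [measurable]: "Y \<in> borel_measurable M" "G \<in> borel_measurable M"
    unfolding Y_def G_def using Z_measurable[OF s0, of "{- q..q}"] Z_measurable[OF su, of "{- r..r}"] by measurable
  have G: "lap (Z (s + u) \<omega>) f = G \<omega>" if "\<omega> \<in> space M" for \<omega>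
    unfolding G_def f_def using that \<eta> su by (intro lap_indicator) (auto simp: sets_Z)
  have Hm [measurable]: "(\<lambda>(\<omega>, \<omega>'). H \<omega> \<omega>') \<in> borel_measurable (M \<Otimes>\<^sub>M N)"
  proof -
    note flow_measurable_pair[OF u0, measurable]
    have "(\<lambda>x. \<integral>\<^sup>+a. indicator {- r..r} (\<phi> a u (snd x)) \<partial>Z s (fst x)) \<in> borel_measurable (M \<Otimes>\<^sub>M N)"
      using s0 by (intro nn_integral_kernel_measurable)
        (auto simp: space_pair_measure sets_Z finite_Z[simplified]
          intro!: measurable_compose[OF measurable_fst Z_measurable] borel_measurable_indicator')
    then show ?thesis unfolding H_def case_prod_beta by measurable
  qed
  have kernel: "scbm_kernel \<beta> \<gamma> N \<phi> u (Z s \<omega>) f = (\<integral>\<omega>'. elap (H \<omega> \<omega>') \<partial>N)" if w: "\<omega> \<in> space M" for \<omega>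
    unfolding scbm_kernel_def
  proof (intro Bochner_Integration.integral_cong refl arg_cong[of _ _ elap])
    fix \<omega>' assume w': "\<omega>' \<in> space N"
    have [measurable]: "(\<lambda>a. \<phi> a u \<omega>') \<in> borel_measurable (Z s \<omega>)"
      using flow_measurable_section[OF u0 w'] sets_Z[OF s0 w] by (simp cong: measurable_cong_sets)
    have "(\<integral>\<^sup>+a. ennreal (psi \<beta> \<gamma> u (f (\<phi> a u \<omega>'))) \<partial>Z s \<omega>) =
      (\<integral>\<^sup>+a. ennreal v * indicator {- r..r} (\<phi> a u \<omega>') \<partial>Z s \<omega>)"
      unfolding f_def v_def psi_indicator by (intro nn_integral_cong) (auto split: split_indicator)
    also have "\<dots> = H \<omega> \<omega>'" unfolding H_def by (rule nn_integral_cmult) measurable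
    finally show "(\<integral>\<^sup>+a. ennreal (psi \<beta> \<gamma> u (f (\<phi> a u \<omega>'))) \<partial>Z s \<omega>) = H \<omega> \<omega>'" .
  qed
  \<comment> \<open>Two weights are needed: \<open>W = Y\<close> for the joint expectation and
    \<open>W = 1\<close> for the marginal one. Measurability in \<open>F s\<close> lets
    \<open>W\<close> pass through the conditional expectation.\<close>
  have swap: "M.expectation (\<lambda>\<omega>. W \<omega> * G \<omega>) = (\<integral>\<omega>'. (\<integral>\<omega>. W \<omega> * elap (H \<omega> \<omega>') \<partial>M) \<partial>N)"
    and int: "integrable N (\<lambda>\<omega>'. \<integral>\<omega>. W \<omega> * elap (H \<omega> \<omega>') \<partial>M)"
    if WF: "W \<in> borel_measurable (F s)" and W1: "\<And>\<omega>. \<bar>W \<omega>\<bar> \<le> 1" for W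
  proof -
    have [measurable]: "W \<in> borel_measurable M" by (rule measurable_from_subalg[OF subalg WF])
    have lm [measurable]: "(\<lambda>\<omega>. lap (Z (s + u) \<omega>) f) \<in> borel_measurable M" by (rule lap_measurable[OF su f])
    have iW: "integrable M (\<lambda>\<omega>. W \<omega> * lap (Z (s + u) \<omega>) f)"
    proof (rule M.integrable_const_bound[where B=1])
      show "AE \<omega> in M. norm (W \<omega> * lap (Z (s + u) \<omega>) f) \<le> 1"
        by (auto simp: abs_mult lap_def abs_elap_le_1 W1 intro!: mult_le_one AE_I2)
    qed measurable
    have iP: "integrable (M \<Otimes>\<^sub>M N) (\<lambda>(\<omega>, \<omega>'). W \<omega> * elap (H \<omega> \<omega>'))"
      by (rule P.integrable_const_bound[where B=1])
        (auto simp: abs_mult abs_elap_le_1 W1 intro!: mult_le_one AE_I2)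
    show "integrable N (\<lambda>\<omega>'. \<integral>\<omega>. W \<omega> * elap (H \<omega> \<omega>') \<partial>M)" by (rule P.integrable_snd[OF iP])
    have "M.expectation (\<lambda>\<omega>. W \<omega> * G \<omega>) = M.expectation (\<lambda>\<omega>. W \<omega> * lap (Z (s + u) \<omega>) f)"
      by (intro Bochner_Integration.integral_cong) (auto simp: G)
    also have "\<dots> = M.expectation (\<lambda>\<omega>. W \<omega> * real_cond_exp M (F s) (\<lambda>\<omega>'. lap (Z (s + u) \<omega>') f) \<omega>)"
      by (rule S.real_cond_exp_intg(2)[OF iW WF lm, symmetric])
    also have "\<dots> = M.expectation (\<lambda>\<omega>. W \<omega> * (\<integral>\<omega>'. elap (H \<omega> \<omega>') \<partial>N))"
    proof (rule integral_cong_AE)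
      show "AE \<omega> in M. W \<omega> * real_cond_exp M (F s) (\<lambda>\<omega>'. lap (Z (s + u) \<omega>') f) \<omega> =
          W \<omega> * (\<integral>\<omega>'. elap (H \<omega> \<omega>') \<partial>N)"
        using markov[OF s0 u0 f] AE_space by eventually_elim (simp add: kernel)
      show "(\<lambda>\<omega>. W \<omega> * (\<integral>\<omega>'. elap (H \<omega> \<omega>') \<partial>N)) \<in> borel_measurable M"
        by measurable
    qed measurable
    also have "\<dots> = (\<integral>\<omega>. (\<integral>\<omega>'. W \<omega> * elap (H \<omega> \<omega>') \<partial>N) \<partial>M)" by simp
    also have "\<dots> = (\<integral>\<omega>'. (\<integral>\<omega>. W \<omega> * elap (H \<omega> \<omega>') \<partial>M) \<partial>N)"
      by (rule P.Fubini_integral[OF iP, symmetric])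
    finally show "M.expectation (\<lambda>\<omega>. W \<omega> * G \<omega>) = (\<integral>\<omega>'. (\<integral>\<omega>. W \<omega> * elap (H \<omega> \<omega>') \<partial>M) \<partial>N)" .
  qed
  have Y1: "\<bar>Y \<omega>\<bar> \<le> 1" for \<omega> by (simp add: Y_def abs_elap_le_1)
  have int1: "integrable N (\<lambda>\<omega>'. \<integral>\<omega>. elap (H \<omega> \<omega>') \<partial>M)"
    and swap1: "M.expectation G = (\<integral>\<omega>'. (\<integral>\<omega>. elap (H \<omega> \<omega>') \<partial>M) \<partial>N)"
    using swap[of "\<lambda>_. 1"] int[of "\<lambda>_. 1"] by simp_all
  define D where "D = psi \<beta> \<gamma> s v * (2 * q + 2 * sqrt s)"
  have "AE \<omega>' in N. bounded {a. \<phi> a u \<omega>' \<in> {- r..r}}"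
    using r by (intro preimage_bounded[OF u]) (auto simp: is_interval_cc)
  then have "AE \<omega>' in N. (\<integral>\<omega>. Y \<omega> * elap (H \<omega> \<omega>') \<partial>M) \<le> M.expectation Y * (\<integral>\<omega>. elap (H \<omega> \<omega>') \<partial>M) + D"
    using AE_space
  proof eventually_elim
    case (elim \<omega>')
    define I where "I = {a. \<phi> a u \<omega>' \<in> {- r..r}}"
    note [measurable] = flow_measurable_section[OF u0 elim(2)]
    have I: "I \<in> sets borel" "bounded I" "is_interval I"
      using elim preimage_interval[OF u0 elim(2) is_interval_cc] by (auto simp: I_def)
    have "H \<omega> \<omega>' = ennreal v * emeasure (Z s \<omega>) I" if "\<omega> \<in> space M" for \<omega>
    proof -
      have "(\<integral>\<^sup>+a. indicator {- r..r} (\<phi> a u \<omega>') \<partial>Z s \<omega>) = (\<integral>\<^sup>+a. indicator I a \<partial>Z s \<omega>)"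
        by (intro nn_integral_cong) (auto simp: I_def split: split_indicator)
      then show ?thesis using I(1) sets_Z[OF s0 that] by (simp add: H_def)
    qed
    then have e: "(\<integral>\<omega>. Y \<omega> * elap (H \<omega> \<omega>') \<partial>M) = (\<integral>\<omega>. Y \<omega> * elap (ennreal v * emeasure (Z s \<omega>) I) \<partial>M)"
      "(\<integral>\<omega>. elap (H \<omega> \<omega>') \<partial>M) = (\<integral>\<omega>. elap (ennreal v * emeasure (Z s \<omega>) I) \<partial>M)"
      by (auto intro!: Bochner_Integration.integral_cong)
    show ?case
      unfolding e D_def unfolding Y_def using p pv by (intro covariance_fixed_interval s \<theta> v q I) simp
  qed
  \<comment> \<open>The error \<open>D\<close> is the same for every interval, so integrating over
    \<open>\<omega>'\<close> leaves it unchanged.\<close>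
  then have "(\<integral>\<omega>'. (\<integral>\<omega>. Y \<omega> * elap (H \<omega> \<omega>') \<partial>M) \<partial>N) \<le>
      (\<integral>\<omega>'. M.expectation Y * (\<integral>\<omega>. elap (H \<omega> \<omega>') \<partial>M) + D \<partial>N)"
    using int[OF YF Y1] int1 by (intro integral_mono_AE) simp_all
  also have "\<dots> = M.expectation Y * (\<integral>\<omega>'. (\<integral>\<omega>. elap (H \<omega> \<omega>') \<partial>M) \<partial>N) + D"
    using int1 by (simp add: N.prob_space)
  finally have "M.expectation (\<lambda>\<omega>. Y \<omega> * G \<omega>) \<le> M.expectation Y * M.expectation G + D"
    unfolding swap[OF YF Y1] swap1 .
  then show ?thesis unfolding Y_def G_def D_def pv .
qed

end

section \<open>The divergence criterion\<close>

text \<open>Condensation over the blocks from \<open>2 ^ n\<close> to \<open>2 ^ Suc n\<close>: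
  there \<open>g\<close> is at most its right-end value, the power at most its left-end value, and
  the length is \<open>2 ^ n\<close>. If the series converged, the integral would be finite.\<close>

lemma dyadic_sum_divergent:
  fixes g :: "real \<Rightarrow> real"
  assumes b: "0 < \<beta>" and g0: "\<forall>t\<ge>0. 0 \<le> g t" and mono: "mono_on {0..} g"
    and div: "(\<integral>\<^sup>+ y. ennreal (g y * y powr (- 1 - 1 / \<beta>)) * indicator {1..} y \<partial>lborel) = \<infinity>"
  shows "\<not> summable (\<lambda>n. g (2 ^ n) * (2 powr (- 1 / \<beta>)) ^ n)"
proof
  define x where "x = 2 powr (- 1 / \<beta> :: real)"
  assume "summable (\<lambda>n. g (2 ^ n) * (2 powr (- 1 / \<beta>)) ^ n)"
  \<comment> \<open>The block bound pairs \<open>g (2 ^ Suc n)\<close> with \<open>x ^ n\<close>, so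
    the series is shifted by one index and one factor \<open>x\<close> is divided out.\<close>
  then have "summable (\<lambda>n. g (2 ^ Suc n) * x ^ Suc n)"
    by (subst summable_Suc_iff) (simp add: x_def)
  then have "summable (\<lambda>n. inverse x * (g (2 ^ Suc n) * x ^ Suc n))"
    by (rule summable_mult)
  then have sm: "summable (\<lambda>n. g (2 ^ Suc n) * x ^ n)"
    by (simp add: x_def field_simps)
  define h where "h n = g (2 ^ Suc n) * (2 ^ n) powr (- 1 - 1 / \<beta>)" for n :: nat
  have h0: "0 \<le> h n" for n using g0 by (simp add: h_def)
  have hx: "h n * 2 ^ n = g (2 ^ Suc n) * x ^ n" for n
  proof -
    have "(2 ^ n) powr (- 1 - 1 / \<beta>) * 2 ^ n = (2 ^ n :: real) powr (- 1 / \<beta>)"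
      by (simp add: powr_diff powr_minus field_simps)
    also have "\<dots> = x ^ n"
      by (simp add: x_def powr_powr powr_realpow[symmetric] mult.commute)
    finally show ?thesis by (simp add: h_def)
  qed
  have pw: "ennreal (g y * y powr (- 1 - 1 / \<beta>)) * indicator {1..} y \<le>
      (\<Sum>n. ennreal (h n) * indicator {2 ^ n..2 ^ Suc n} y)" for y :: real
  proof (cases "1 \<le> y")
    case True
    define n where "n = nat \<lfloor>log 2 y\<rfloor>"
    have l0: "0 \<le> log 2 y" using True by simp
    then have "real n \<le> log 2 y" "log 2 y < real n + 1" by (auto simp: n_def) 
    then have "2 powr real n \<le> y" "y < 2 powr (real n + 1)"
      using True by (auto simp: le_log_iff log_less_iff)
    then have n: "2 ^ n \<le> y" "y \<le> 2 ^ Suc n"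
      by (auto simp: powr_add powr_realpow)
    have "g y \<le> g (2 ^ Suc n)" using n True by (intro mono_onD[OF mono]) auto
    moreover have "y powr (- 1 - 1 / \<beta>) \<le> (2 ^ n) powr (- 1 - 1 / \<beta>)"
      using n b by (intro powr_mono2') (auto simp: field_simps)
    ultimately have "g y * y powr (- 1 - 1 / \<beta>) \<le> h n"
      unfolding h_def using g0 by (intro mult_mono) auto
    then have "ennreal (g y * y powr (- 1 - 1 / \<beta>)) * indicator {1..} y \<le> ennreal (h n) * indicator {2 ^ n..2 ^ Suc n} y"
      using n True by (simp add: ennreal_leI)
    also have "\<dots> = (\<Sum>i\<in>{n}. ennreal (h i) * indicator {2 ^ i..2 ^ Suc i} y)"
      by (simp only: sum.insert sum.empty finite.emptyI empty_iff not_False_eq_True add_0_right)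
    also have "\<dots> \<le> (\<Sum>n. ennreal (h n) * indicator {2 ^ n..2 ^ Suc n} y)"
      by (rule sum_le_suminf) auto
    finally show ?thesis .
  qed simp
  have "(\<integral>\<^sup>+ y. ennreal (g y * y powr (- 1 - 1 / \<beta>)) * indicator {1..} y \<partial>lborel) \<le>
      (\<integral>\<^sup>+ y. (\<Sum>n. ennreal (h n) * indicator {2 ^ n..2 ^ Suc n :: real} y) \<partial>lborel)"
    by (intro nn_integral_mono pw)
  also have "\<dots> = (\<Sum>n. \<integral>\<^sup>+ y. ennreal (h n) * indicator {2 ^ n..2 ^ Suc n :: real} y \<partial>lborel)"
    by (rule nn_integral_suminf) auto
  also have "\<dots> = (\<Sum>n. ennreal (h n * 2 ^ n))"
  proof (intro suminf_cong)
    fix n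
    show "(\<integral>\<^sup>+ y. ennreal (h n) * indicator {2 ^ n..2 ^ Suc n :: real} y \<partial>lborel) = ennreal (h n * 2 ^ n)"
      using h0[of n] by (subst nn_integral_cmult_indicator) (auto simp: ennreal_mult)
  qed
  also have "\<dots> = ennreal (\<Sum>n. h n * 2 ^ n)"
    using h0 sm unfolding hx[symmetric] by (intro suminf_ennreal2) simp_all
  finally show False using div by (simp add: top_unique)
qed

lemma geometric_tail_le:
  fixes x :: real
  assumes "0 \<le> x" "x \<le> 1 / 2"
  shows "(\<Sum>m = Suc n..<N. x ^ m) \<le> x ^ n"
proof (cases "Suc n \<le> N")
  case True
  then obtain k where N: "N = Suc n + k" using le_Suc_ex by blast
  \<comment> \<open>The induction carries the remainder \<open>x ^ (n + k)\<close>: the next term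
    and the next remainder together fit into it because \<open>2 * x \<le> 1\<close>.\<close>
  have "(\<Sum>m = Suc n..<Suc n + k. x ^ m) + x ^ (n + k) \<le> x ^ n"
  proof (induction k)
    case (Suc k)
    have "2 * x ^ (n + Suc k) \<le> x ^ (n + k)"
      using mult_right_mono[OF assms(2), of "x ^ (n + k)"] assms(1) by simp
    then show ?case using Suc by simp
  qed simp
  moreover have "0 \<le> x ^ (n + k)" using assms by simp
  ultimately show ?thesis unfolding N by linarith
qed (use assms in auto)

theorem theorem4p6:
  fixes \<beta> \<gamma> :: real and g :: "real \<Rightarrow> real"
    and N :: "'b measure" and \<phi> :: "real \<Rightarrow> real \<Rightarrow> 'b \<Rightarrow> real"
    and M :: "'a measure" and F :: "real \<Rightarrow> 'a measure" and Z :: "real \<Rightarrow> 'a \<Rightarrow> real measure"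
  assumes "0 < \<beta>" and "\<beta> \<le> 1" and "0 < \<gamma>"
    and "coalescing_brownian_flow N \<phi>"
    and "scbm \<beta> \<gamma> N \<phi> M F Z lborel"
    and "\<forall>t\<ge>0. 0 \<le> g t" and "mono_on {0..} g" and "\<forall>t\<ge>0. continuous (at_right t) g"
    and "(\<integral>\<^sup>+ y. ennreal (g y * y powr (- 1 - 1 / \<beta>)) * indicator {1..} y \<partial>lborel) = \<infinity>"
  shows "AE \<omega> in M. scbm_tau g Z \<omega> = \<infinity>"
proof -
  interpret scbm_process N \<phi> \<beta> \<gamma> M F Z
    using assms by unfold_locales auto
  define x where "x = 2 powr (- 1 / \<beta>)"
  define t where "t n = (2 :: real) ^ n" for n :: nat
  define \<kappa> where "\<kappa> = ((1 + \<beta>) / (1 + \<beta> + \<gamma> * \<beta>)) powr (1 / \<beta>)"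
  define p where "p n = \<kappa> * x ^ n" for n
  \<comment> \<open>\<open>inverse (x ^ n)\<close> is \<open>t n powr (1 / \<beta>)\<close>. The cap
    keeps \<open>p n * r n\<close> at most 1, and \<open>r n \<le> g (t n)\<close> means that mass
    found in the smaller interval also lies in the larger one.\<close>
  define r where "r n = min (g (t n)) (inverse (x ^ n))" for n
  define Y where "Y n \<omega> = elap (ennreal (x ^ n) * emeasure (Z (t n) \<omega>) {- r n..r n})" for n \<omega>
  define X where "X n \<omega> = 1 - Y n \<omega>" for n \<omega>
  \<comment> \<open>The ratio of the geometric bound on \<open>p n * sqrt (t n)\<close>; it is below
    1 because \<open>x \<le> 1 / 2\<close>, which comes from \<open>\<beta> \<le> 1\<close>.\<close>
  define q where "q = x * sqrt 2"
  have x: "0 < x" "x \<le> 1 / 2"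
  proof -
    show "0 < x" by (simp add: x_def)
    have "x \<le> 2 powr (- 1)" unfolding x_def using assms(1,2) by (intro powr_mono) (auto simp: field_simps)
    then show "x \<le> 1 / 2" by (simp add: powr_minus)
  qed
  have q: "0 < q" "q < 1"
  proof -
    show "0 < q" using x by (simp add: q_def)
    have "q \<le> 1 / 2 * sqrt 2" unfolding q_def using x by (intro mult_right_mono) auto
    also have "\<dots> < 1" using real_sqrt_less_mono[of 2 4] by simp
    finally show "q < 1" .
  qed
  have k: "0 < \<kappa>" "\<kappa> \<le> 1"
  proof -
    have "0 < 1 + \<beta> + \<gamma> * \<beta>" using assms(1,3) by (simp add: add_pos_pos)
    then show "0 < \<kappa>" "\<kappa> \<le> 1" using assms(1,3) by (auto simp: \<kappa>_def intro!: powr_le1)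
  qed
  have t: "0 < t n" for n by (simp add: t_def)
  have r0: "0 \<le> r n" for n using assms(6) x t[of n] by (simp add: r_def)
  have tx: "t n powr (- 1 / \<beta>) = x ^ n" for n
    by (simp add: t_def x_def powr_powr powr_realpow[symmetric] mult.commute)
  have psi: "psi \<beta> \<gamma> (t n) (x ^ n) = p n" for n
    using psi_self_similar[OF assms(1,3) t[of n]] unfolding tx p_def \<kappa>_def .
  have p0: "0 < p n" for n using k x by (simp add: p_def)
  have p_sqrt: "p n * sqrt (t n) \<le> q ^ n" for n
  proof -
    have "p n * sqrt (t n) = \<kappa> * q ^ n" by (simp add: p_def q_def t_def real_sqrt_power power_mult_distrib)
    also have "\<dots> \<le> q ^ n" using k q by (intro mult_left_le_one_le) auto
    finally show ?thesis .
  qed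
  have pr: "p n * r n = \<kappa> * min (g (t n) * x ^ n) 1" for n
    using x by (auto simp: p_def r_def min_def field_simps)
  have Ymeas [measurable]: "Y n \<in> borel_measurable M" for n
    unfolding Y_def using Z_measurable[of "t n" "{- r n..r n}"] t[of n] by simp
  have Y01: "0 \<le> Y n \<omega>" "Y n \<omega> \<le> 1" for n \<omega> by (simp_all add: Y_def elap_nonneg elap_le_1)
  have iY [simp]: "integrable M (Y n)" for n
    by (rule M.integrable_const_bound[where B=1]) (use Y01 in auto)
  have iYY [simp]: "integrable M (\<lambda>\<omega>. Y n \<omega> * Y m \<omega>)" for n m
    by (rule M.integrable_const_bound[where B=1]) (use Y01 in \<open>auto simp: abs_mult intro!: mult_le_one\<close>)
  have EX: "M.expectation (X n) = 1 - M.expectation (Y n)" for n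
    unfolding X_def by (simp add: M.prob_space)
  have lower: "p n * r n / 7 \<le> M.expectation (X n)" for n
  proof -
    have "p n * r n \<le> 1"
    proof -
      have "\<kappa> * min (g (t n) * x ^ n) 1 \<le> 1 * 1"
        using k r0[of n] x assms(6) t[of n] by (intro mult_mono) (auto simp: less_imp_le)
      then show ?thesis by (simp add: pr)
    qed
    moreover have "p n * sqrt (t n) \<le> 1"
      using p_sqrt[of n] power_le_one[of q n] q by simp
    \<comment> \<open>The 6 is 2 from \<open>p n * r n \<le> 1\<close> plus 4 from
      \<open>p n * sqrt (t n) \<le> 1\<close>.\<close>
    ultimately have "2 * p n * (r n + 2 * sqrt (t n)) \<le> 6" by (simp add: algebra_simps)
    then have "p n * r n / 7 \<le> 1 - N.expectation (\<lambda>\<omega>. elap (ennreal (p n) * preimage_length (t n) {- r n..r n} \<omega>))"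
      using t r0 p0[of n] by (intro expectation_elap_preimage_length) auto
    also have "\<dots> = M.expectation (X n)"
      unfolding EX Y_def using expectation_elap[of "t n" "x ^ n" "{- r n..r n}"] t[of n] x by (simp add: psi)
    finally show ?thesis .
  qed
  \<comment> \<open>If the capped series converged, its terms would tend to 0, so the cap would
    eventually be inactive and the uncapped series would converge too.\<close>
  have div: "\<not> summable (\<lambda>n. M.expectation (X n))"
  proof
    assume "summable (\<lambda>n. M.expectation (X n))"
    then have "summable (\<lambda>n. p n * r n / 7)"
      by (rule summable_comparison_test'[where N=0]) (use lower p0 r0 in \<open>auto simp: less_imp_le\<close>)
    then have "summable (\<lambda>n. (7 / \<kappa>) * (p n * r n / 7))" by (rule summable_mult)
    then have min: "summable (\<lambda>n. min (g (t n) * x ^ n) 1)" using k by (simp add: pr)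
    then have "(\<lambda>n. min (g (t n) * x ^ n) 1) \<longlonglongrightarrow> 0" by (rule summable_LIMSEQ_zero)
    then have "eventually (\<lambda>n. min (g (t n) * x ^ n) 1 < 1) sequentially"
      by (rule order_tendstoD) simp
    then have "eventually (\<lambda>n. min (g (t n) * x ^ n) 1 = g (t n) * x ^ n) sequentially"
      by eventually_elim (auto simp: min_def split: if_splits)
    then have "summable (\<lambda>n. g (t n) * x ^ n)" using min summable_cong by fast
    then show False using dyadic_sum_divergent[OF assms(1,6,7,9)] by (simp add: x_def t_def)
  qed
  have "AE \<omega> in M. \<forall>k. \<exists>n\<ge>k. X n \<omega> \<noteq> 0"
  proof (rule M.second_moment_infinitely_often)
    show "X n \<in> borel_measurable M" for n unfolding X_def by measurable
    show "0 \<le> X n \<omega>" "X n \<omega> \<le> 1" for n \<omega> using Y01 by (simp_all add: X_def)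
    \<comment> \<open>Passing from \<open>Y\<close> to \<open>X = 1 - Y\<close> leaves covariances
      unchanged, so the error is the one from \<open>covariance\<close>, with rate
      \<open>p m\<close>.\<close>
    show "M.expectation (\<lambda>\<omega>. X n \<omega> * X m \<omega>) \<le> M.expectation (X n) * M.expectation (X m)
        + p m * (2 * r n + 2 * sqrt (t n))" if nm: "n < m" for n m
    proof -
      have lt: "t n < t m" using nm by (simp add: t_def)
      have pp: "p m \<le> p n" unfolding p_def using nm x k by (intro mult_left_mono power_decreasing) auto
      have "M.expectation (\<lambda>\<omega>. Y n \<omega> * Y m \<omega>) \<le> M.expectation (Y n) * M.expectation (Y m)
        + p m * (2 * r n + 2 * sqrt (t n))"
        using covariance[of "t n" "t m - t n" "x ^ n" "x ^ m" "r n" "r m"] t[of n] lt x r0 pp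
        by (simp add: psi Y_def[abs_def])
      moreover have "M.expectation (\<lambda>\<omega>. X n \<omega> * X m \<omega>) =
          1 - M.expectation (Y n) - M.expectation (Y m) + M.expectation (\<lambda>\<omega>. Y n \<omega> * Y m \<omega>)"
        unfolding X_def by (simp add: algebra_simps M.prob_space)
      ultimately show ?thesis unfolding EX by (simp add: algebra_simps)
    qed
    \<comment> \<open>The geometric tail reduces the row sum to its value at scale \<open>n\<close>.
      The lower bound \<open>p n * r n / 7\<close> on the mean then gives the factor 14, and the
      displacement term is summable in \<open>n\<close>.\<close>
    show "(\<Sum>m = Suc n..<L. p m * (2 * r n + 2 * sqrt (t n))) \<le> 14 * M.expectation (X n) + 2 * q ^ n" for n L
    proof -
      have "(\<Sum>m = Suc n..<L. p m * (2 * r n + 2 * sqrt (t n))) =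
          \<kappa> * (\<Sum>m = Suc n..<L. x ^ m) * (2 * r n + 2 * sqrt (t n))"
        by (simp add: p_def sum_distrib_left sum_distrib_right)
      also have "\<dots> \<le> \<kappa> * x ^ n * (2 * r n + 2 * sqrt (t n))"
        using geometric_tail_le[of x n L] x k r0[of n] t[of n] by (intro mult_right_mono mult_left_mono) auto
      also have "\<dots> = 2 * (p n * r n) + 2 * (p n * sqrt (t n))" by (simp add: p_def algebra_simps)
      also have "\<dots> \<le> 14 * M.expectation (X n) + 2 * q ^ n" using lower[of n] p_sqrt[of n] by simp
      finally show ?thesis .
    qed
    show "(\<Sum>n<L. 2 * q ^ n) \<le> (\<Sum>n. 2 * q ^ n)" for L
      using q by (intro sum_le_suminf summable_mult summable_geometric) auto
  qed (use div in auto)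
  then show ?thesis
    using AE_space
  proof eventually_elim
    case (elim \<omega>)
    \<comment> \<open>A nonzero \<open>X n\<close> means positive mass in \<open>[-r n, r n]\<close>
      at time \<open>2 ^ n\<close>, so this time enters the supremum defining
      \<open>scbm_tau\<close>.\<close>
    have big: "\<exists>n\<ge>k. ennreal (2 ^ n) \<le> scbm_tau g Z \<omega>" for k
    proof -
      obtain n where n: "n \<ge> k" "X n \<omega> \<noteq> 0" using elim by blast
      then have "emeasure (Z (t n) \<omega>) {- r n..r n} \<noteq> 0"
        by (auto simp: X_def Y_def elap_eq_1_iff)
      moreover have "emeasure (Z (t n) \<omega>) {- r n..r n} \<le> emeasure (Z (t n) \<omega>) {- g (t n)..g (t n)}"
        using elim(2) t[of n] by (intro emeasure_mono) (auto simp: r_def sets_Z less_imp_le)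
      ultimately have "emeasure (Z (t n) \<omega>) {- g (t n)..g (t n)} \<noteq> 0" by auto
      then have "ennreal (t n) \<le> scbm_tau g Z \<omega>"
        unfolding scbm_tau_def using t[of n] by (intro Sup_upper) (auto simp: less_imp_le)
      then show ?thesis using n by (auto simp: t_def)
    qed
    show ?case
    proof (rule ccontr)
      assume "scbm_tau g Z \<omega> \<noteq> \<infinity>"
      then obtain y where y: "scbm_tau g Z \<omega> = ennreal y" "0 \<le> y" by (cases "scbm_tau g Z \<omega>") auto
      obtain k where k: "y < 2 ^ k" using real_arch_pow[of 2 y] by auto
      obtain n where n: "n \<ge> k" "ennreal (2 ^ n) \<le> ennreal y" using big[of k] y by auto
      have "(2 :: real) ^ k \<le> 2 ^ n" using n by simp
      moreover have "2 ^ n \<le> y" using n(2) y(2) by (subst (asm) ennreal_le_iff) auto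
      ultimately show False using k by linarith
    qed
  qed
qed

end
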